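(* Let $(\mathbb{N},\mathcal{E})$ be a non-amenable coarse space of bounded geometry. Assume that there exists a highly computable symmetric entourage $E\in\mathcal{E}$ such that $|E[F]|\geq 6|F|$ for all finite $F\subset\mathbb{N}$. Then there are two computable permutations $\sigma,\pi\in \mathrm{Sym}(\mathbb{N})$ such that $\langle\sigma,\pi\rangle$ is a free (of rank $2$) semi-regular subgroup of the wobbling group $\mathcal{W}(\mathbb{N},\mathcal{E})$.
   Context: For a relation $E\subseteq X\times X$, $x\in X$ and $A\subseteq X$, put $E[x]:=\{y\in X : (x,y)\in E\}$ and $E[A]:=\bigcup_{x\in A}E[x]$. A coarse space is a pair $(X,\mathcal{E})$ where $X$ is a set and $\mathcal{E}$ is a collection of subsets of $X\times X$ (called entourages) such that: the diagonal $\Delta_X\in\mathcal{E}$; if $F\subseteq E\in\mathcal{E}$ then $F\in\mathcal{E}$; if $E,F\in\mathcal{E}$ then $E\cup F,\ E^{-1},\ E\circ F\in\mathcal{E}$. It has bounded geometry if for each $E\in\mathcal{E}$ and every $x\in X$ the set $E[x]$ is finite. A coarse space $(X,\mathcal{E})$ of bounded geometry is amenable if for every $\theta>1$ and every $E\in\mathcal{E}$ there is a non-empty finite $F\subseteq X$ with $|E[F]|\leq\theta|F|$; otherwise it is non-amenable. The wobbling group is $\mathcal{W}(X,\mathcal{E}):=\{\alpha\in \mathrm{Sym}(X) : \{(x,\alpha(x)) : x\in X\}\in\mathcal{E}\}$. A subgroup $G\leq \mathrm{Sym}(X)$ is semi-regular if no non-identity element of $G$ has a fixed point in $X$. A symmetric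 relation $E\subseteq\mathbb{N}\times\mathbb{N}$ is highly computable if it is a computable set of pairs, every $E[n]$ is finite, and the function $n\mapsto|E[n]|$ is computable. *)

theory Defs
  imports Complex_Main "HOL-Algebra.Bij" "HOL-Algebra.Generated_Groups"
begin

section \<open>Coarse spaces\<close>

text \<open>
  The neighbourhoods \<open>E[x]\<close> and \<open>E[A]\<close> are the relational images \<open>E `` {x}\<close> and \<open>E `` A\<close>.
\<close>

locale coarse_space =
  fixes X :: "'a set" and \<E> :: "('a \<times> 'a) set set"
  assumes entourage_subset: "E \<in> \<E> \<Longrightarrow> E \<subseteq> X \<times> X"
    and diagonal: "Id_on X \<in> \<E>"
    and subset_closed: "E \<in> \<E> \<Longrightarrow> F \<subseteq> E \<Longrightarrow> F \<in> \<E>"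
    and union_closed: "E \<in> \<E> \<Longrightarrow> F \<in> \<E> \<Longrightarrow> E \<union> F \<in> \<E>"
    and converse_closed: "E \<in> \<E> \<Longrightarrow> E\<inverse> \<in> \<E>"
    and comp_closed: "E \<in> \<E> \<Longrightarrow> F \<in> \<E> \<Longrightarrow> E O F \<in> \<E>"

locale bounded_geometry_coarse_space = coarse_space +
  assumes bounded_geometry: "E \<in> \<E> \<Longrightarrow> x \<in> X \<Longrightarrow> finite (E `` {x})"

definition amenable :: "'a set \<Rightarrow> ('a \<times> 'a) set set \<Rightarrow> bool" where
  "amenable X \<E> \<longleftrightarrow>
     (\<forall>\<theta>::real. \<theta> > 1 \<longrightarrow> (\<forall>E\<in>\<E>. \<exists>F. F \<noteq> {} \<and> finite F \<and> F \<subseteq> X \<and>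
        real (card (E `` F)) \<le> \<theta> * real (card F)))"


section \<open>Permutation groups\<close>

text \<open>\<open>Sym(X)\<close> is \<^term>\<open>BijGroup X\<close>.\<close>

definition wobbling_group :: "'a set \<Rightarrow> ('a \<times> 'a) set set \<Rightarrow> ('a \<Rightarrow> 'a) monoid" where
  "wobbling_group X \<E> =
     (BijGroup X)\<lparr>carrier := {\<alpha> \<in> carrier (BijGroup X). {(x, \<alpha> x) | x. x \<in> X} \<in> \<E>}\<rparr>"

definition semi_regular :: "'a set \<Rightarrow> ('a \<Rightarrow> 'a) set \<Rightarrow> bool" where
  "semi_regular X G \<longleftrightarrow> subgroup G (BijGroup X) \<and>
     (\<forall>g\<in>G. g \<noteq> \<one>\<^bsub>BijGroup X\<^esub> \<longrightarrow> (\<forall>x\<in>X. g x \<noteq> x))"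


section \<open>Free groups\<close>

text \<open>
  A group word is a list of letters \<open>(s, b)\<close>, where \<open>(s, True)\<close> stands for \<open>s\<close> and
  \<open>(s, False)\<close> for the inverse of \<open>s\<close>.
\<close>

definition reduced_word :: "('a \<times> bool) list \<Rightarrow> bool" where
  "reduced_word w \<longleftrightarrow> successively (\<lambda>(s, b) (t, c). s = t \<longrightarrow> b = c) w"

fun word_value :: "('a, 'm) monoid_scheme \<Rightarrow> ('a \<times> bool) list \<Rightarrow> 'a" where
  "word_value G [] = \<one>\<^bsub>G\<^esub>"
| "word_value G ((s, b) # w) = (if b then s else inv\<^bsub>G\<^esub> s) \<otimes>\<^bsub>G\<^esub> word_value G w"

definition free_basis :: "('a, 'm) monoid_scheme \<Rightarrow> 'a set \<Rightarrow> bool" where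
  "free_basis G S \<longleftrightarrow> S \<subseteq> carrier G \<and> generate G S = carrier G \<and>
     (\<forall>w. fst ` set w \<subseteq> S \<and> reduced_word w \<and> w \<noteq> [] \<longrightarrow> word_value G w \<noteq> \<one>\<^bsub>G\<^esub>)"

definition free_group_of_rank :: "('a, 'm) monoid_scheme \<Rightarrow> nat \<Rightarrow> bool" where
  "free_group_of_rank G n \<longleftrightarrow> group G \<and> (\<exists>S. finite S \<and> card S = n \<and> free_basis G S)"


section \<open>Computability\<close>

text \<open>
  \<open>total_recursive n f\<close>: the total function \<open>f\<close>, applied to argument lists of length \<open>n\<close>, is
  recursive. This is the class of total \<open>\<mu>\<close>-recursive functions: the minimisation operator is
  only applied to functions for which it yields a total result. The values on lists of other
  lengths are irrelevant.
\<close>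

inductive total_recursive :: "nat \<Rightarrow> (nat list \<Rightarrow> nat) \<Rightarrow> bool" where
  zero: "total_recursive n (\<lambda>_. 0)"
| succ: "total_recursive 1 (\<lambda>xs. Suc (hd xs))"
| proj: "i < n \<Longrightarrow> total_recursive n (\<lambda>xs. xs ! i)"
| comp: "total_recursive (length gs) f \<Longrightarrow> (\<forall>g\<in>set gs. total_recursive n g) \<Longrightarrow>
    total_recursive n (\<lambda>xs. f (map (\<lambda>g. g xs) gs))"
| prim_rec: "total_recursive n f \<Longrightarrow> total_recursive (Suc (Suc n)) g \<Longrightarrow>
    total_recursive (Suc n)
      (\<lambda>xs. rec_nat (f (tl xs)) (\<lambda>k r. g (k # r # tl xs)) (hd xs))"
| minimise: "total_recursive (Suc n) f \<Longrightarrow>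
    (\<forall>xs. length xs = n \<longrightarrow> (\<exists>k. f (k # xs) = 0)) \<Longrightarrow>
    total_recursive n (\<lambda>xs. LEAST k. f (k # xs) = 0)"

definition computable_fun :: "(nat \<Rightarrow> nat) \<Rightarrow> bool" where
  "computable_fun h \<longleftrightarrow> (\<exists>f. total_recursive 1 f \<and> (\<forall>x. f [x] = h x))"

definition computable_rel :: "(nat \<times> nat) set \<Rightarrow> bool" where
  "computable_rel E \<longleftrightarrow>
     (\<exists>f. total_recursive 2 f \<and> (\<forall>x y. f [x, y] = (if (x, y) \<in> E then 1 else 0)))"

definition highly_computable :: "(nat \<times> nat) set \<Rightarrow> bool" where
  "highly_computable E \<longleftrightarrow> computable_rel E \<and> (\<forall>n. finite (E `` {n})) \<and>
     computable_fun (\<lambda>n. card (E `` {n}))"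

end

theory Submission
  imports Defs "HOL-Library.Nat_Bijection"
begin

text \<open>
  Put \<open>K = E O E\<close>, so that \<open>K\<close> is reflexive, symmetric and \<open>|K[F]| \<ge> 36|F|\<close>. We build a forest on the
  natural numbers with edges in \<open>K\<close>, labelled by the letters \<open>0, 1, 2, 3\<close> (for \<open>\<sigma>\<close>, \<open>\<pi>\<close> and their
  inverses), in which every vertex has exactly one neighbour for each letter and every ascending path
  ends in a root: each component is then a copy of the Cayley graph of the free group. If a reduced
  word fixes a vertex, conjugating it by the label of the edge to the parent produces a non-empty
  reduced word fixing the parent; at a root this is absurd, since all steps lead downwards.

  The forest grows by finite blocks. A stage is a finite forest whose set \<open>P\<close> of complete vertices
  satisfies \<open>|K[F] - K[P]| \<ge> 10|F|\<close> for all finite \<open>F\<close> near \<open>P\<close> and disjoint from \<open>P\<close>, which is decidable.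
  Far from \<open>P\<close> this holds anyway, hence \<open>|K[F] - K[P]| \<ge> 5|F|\<close> for all finite \<open>F\<close> disjoint from \<open>P\<close>. To
  complete a vertex \<open>n\<close>, let \<open>Q \<supseteq> P \<union> {n}\<close> minimise \<open>|K[Q]| - 10|Q|\<close>; the marriage theorem gives the
  vertices of \<open>Q - P\<close> five private candidates for children each, and since only one of them lies in
  \<open>Q - P\<close> on average, four can be kept without creating a cycle. Minimality of \<open>Q\<close> restores the
  condition. As the condition is decidable, the next stage can be found by unbounded search.
\<close>

section \<open>Recursive functions of environments\<close>

text \<open>The infinite environment hides the arity, so that terms with any number of free
  variables compose freely. The equation holds for every \<open>e\<close>, so \<open>F\<close>
  depends only on the first \<open>n\<close> coordinates.\<close>

definition recursive_in :: "nat \<Rightarrow> ((nat \<Rightarrow> nat) \<Rightarrow> nat) \<Rightarrow> bool" where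
  "recursive_in n F \<longleftrightarrow> (\<exists>f. total_recursive n f \<and> (\<forall>e. F e = f (map e [0..<n])))"

definition recursive :: "((nat \<Rightarrow> nat) \<Rightarrow> nat) \<Rightarrow> bool" where
  "recursive F \<longleftrightarrow> (\<exists>n. recursive_in n F)"

definition decidable :: "((nat \<Rightarrow> nat) \<Rightarrow> bool) \<Rightarrow> bool" where
  "decidable P \<longleftrightarrow> recursive (\<lambda>e. if P e then 1 else 0)"

lemma map_env_nth: "length xs = n \<Longrightarrow> map ((!) xs) [0..<n] = xs"
  by (metis map_nth)

lemma recursive_in_comp:
  assumes f: "total_recursive n f" and S: "\<And>i. i < n \<Longrightarrow> recursive_in m (S i)"
  shows "recursive_in m (\<lambda>e. f (map (\<lambda>i. S i e) [0..<n]))"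
proof -
  have "\<exists>g. \<forall>i<n. total_recursive m (g i) \<and> (\<forall>e. S i e = g i (map e [0..<m]))"
    using S unfolding recursive_in_def by metis
  then obtain g where g: "\<And>i. i < n \<Longrightarrow> total_recursive m (g i)"
    "\<And>i e. i < n \<Longrightarrow> S i e = g i (map e [0..<m])" by blast
  define gs where "gs = map g [0..<n]"
  have "total_recursive m (\<lambda>xs. f (map (\<lambda>g. g xs) gs))"
    by (rule total_recursive.comp) (use f g(1) in \<open>auto simp: gs_def\<close>)
  moreover have "f (map (\<lambda>i. S i e) [0..<n]) = f (map (\<lambda>g. g (map e [0..<m])) gs)" for e
    by (rule arg_cong[of _ _ f]) (auto simp: gs_def g(2))
  ultimately show ?thesis unfolding recursive_in_def by blast
qed

lemma recursive_in_var: "i < n \<Longrightarrow> recursive_in n (\<lambda>e. e i)"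
  unfolding recursive_in_def
  by (rule exI[of _ "\<lambda>xs. xs ! i"]) (auto intro: total_recursive.proj)

lemma recursive_in_mono:
  assumes "recursive_in n F" "n \<le> m" shows "recursive_in m F"
proof -
  obtain f where f: "total_recursive n f" "\<And>e. F e = f (map e [0..<n])"
    using assms(1) unfolding recursive_in_def by blast
  have "recursive_in m (\<lambda>e. f (map (\<lambda>i. e i) [0..<n]))"
    by (rule recursive_in_comp[OF f(1)]) (use assms(2) in \<open>auto intro: recursive_in_var\<close>)
  moreover have "F = (\<lambda>e. f (map (\<lambda>i. e i) [0..<n]))"
    by (rule ext) (rule f(2))
  ultimately show ?thesis by simp
qed

text \<open>Only the coordinates below the arity of \<open>H\<close> matter, so finitely many of the
  \<open>S i\<close> are involved and their arities have a maximum.\<close>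

lemma recursive_subst:
  assumes "recursive H" and S: "\<And>i. recursive (S i)"
  shows "recursive (\<lambda>e. H (\<lambda>i. S i e))"
proof -
  obtain n f where f: "total_recursive n f" "\<And>e. H e = f (map e [0..<n])"
    using assms(1) unfolding recursive_def recursive_in_def by blast
  obtain k where k: "\<And>i. recursive_in (k i) (S i)"
    using S unfolding recursive_def by metis
  define m where "m = Max (insert 0 (k ` {..<n}))"
  have "recursive_in m (S i)" if "i < n" for i
    by (rule recursive_in_mono[OF k]) (use that in \<open>auto simp: m_def intro!: Max_ge\<close>)
  then have "recursive_in m (\<lambda>e. f (map (\<lambda>i. S i e) [0..<n]))"
    by (rule recursive_in_comp[OF f(1)])
  then show ?thesis unfolding recursive_def f(2) by blast
qed

lemma recursive_var: "recursive (\<lambda>e. e i)"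
  unfolding recursive_def using recursive_in_var[of i "Suc i"] by blast

lemma recursive_zero: "recursive (\<lambda>e. 0)"
  unfolding recursive_def recursive_in_def using total_recursive.zero by blast

lemma recursive_app1:
  assumes "recursive (\<lambda>e. h (e 0))" "recursive a"
  shows "recursive (\<lambda>e. h (a e))"
  using recursive_subst[OF assms(1), of "\<lambda>i. a"] assms(2) by simp

lemma recursive_app2:
  assumes "recursive (\<lambda>e. h (e 0) (e 1))" "recursive a" "recursive b"
  shows "recursive (\<lambda>e. h (a e) (b e))"
  using recursive_subst[OF assms(1), of "\<lambda>i. if i = 0 then a else b"] assms(2,3) by simp

lemma recursive_app4:
  assumes "recursive (\<lambda>e. h (e 0) (e 1) (e 2) (e 3))"
    "recursive a" "recursive b" "recursive c" "recursive d"
  shows "recursive (\<lambda>e. h (a e) (b e) (c e) (d e))"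
  using recursive_subst[OF assms(1), of
    "\<lambda>i. if i = 0 then a else if i = 1 then b else if i = 2 then c else d"] assms(2-) by simp

lemmas decidable_app1 = recursive_app1[of "\<lambda>x. if h x then 1 else 0" for h, folded decidable_def]
lemmas decidable_app2 = recursive_app2[of "\<lambda>x y. if h x y then 1 else 0" for h, folded decidable_def]
lemmas decidable_app4 = recursive_app4[of "\<lambda>x y z u. if h x y z u then 1 else 0" for h, folded decidable_def]

section \<open>Primitive recursion, definition by cases, arithmetic and bounded sums\<close>

lemma recursive_Suc:
  assumes "recursive a" shows "recursive (\<lambda>e. Suc (a e))"
proof (rule recursive_app1[OF _ assms])
  have "recursive_in 1 (\<lambda>e. Suc (e 0))"
    unfolding recursive_in_def by (rule exI, rule conjI, rule total_recursive.succ) simp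
  then show "recursive (\<lambda>e. Suc (e 0))" unfolding recursive_def by blast
qed

lemma recursive_const: "recursive (\<lambda>e. c)"
  by (induction c) (auto intro: recursive_zero recursive_Suc)

lemma map_Cons_env: "map e [0..<Suc n] = e 0 # map (\<lambda>i. e (Suc i)) [0..<n]"
  by (rule nth_equalityI) (auto simp: nth_Cons simp del: upt_Suc split: nat.split)

text \<open>Binding a variable pushes a value in front of the environment, so the body of a binder
  sees the old environment as \<open>\<lambda>i. e (Suc i)\<close>.\<close>

lemma recursive_rec_nat:
  assumes A: "recursive A" and B: "recursive (\<lambda>e. B (e 0) (e 1) (\<lambda>i. e (Suc (Suc i))))"
    and N: "recursive N"
  shows "recursive (\<lambda>e. rec_nat (A e) (\<lambda>k r. B k r e) (N e))"
proof -
  obtain n1 where n1: "recursive_in n1 A" using A unfolding recursive_def by blast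
  obtain n2 where n2: "recursive_in n2 (\<lambda>e. B (e 0) (e 1) (\<lambda>i. e (Suc (Suc i))))"
    using B unfolding recursive_def by blast
  define m where "m = max n1 n2"
  obtain a where a: "total_recursive m a" "\<And>e. A e = a (map e [0..<m])"
    using recursive_in_mono[OF n1, of m] unfolding m_def recursive_in_def by auto
  obtain b where b: "total_recursive (Suc (Suc m)) b"
    "\<And>e. B (e 0) (e 1) (\<lambda>i. e (Suc (Suc i))) = b (map e [0..<Suc (Suc m)])"
    using recursive_in_mono[OF n2, of "Suc (Suc m)"] unfolding recursive_in_def m_def
    using le_SucI max.cobounded2 by blast
  have B_eq: "B k r e = b (k # r # map e [0..<m])" for k r e
    using b(2)[of "\<lambda>i. case i of 0 \<Rightarrow> k | Suc i \<Rightarrow> (case i of 0 \<Rightarrow> r | Suc i \<Rightarrow> e i)"]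
    by (simp add: map_Cons_env del: upt_Suc)
  have "recursive_in (Suc m) (\<lambda>e. rec_nat (A (\<lambda>i. e (Suc i))) (\<lambda>k r. B k r (\<lambda>i. e (Suc i))) (e 0))"
    unfolding recursive_in_def
    by (rule exI, rule conjI, rule total_recursive.prim_rec[OF a(1) b(1)])
       (simp add: a(2) B_eq map_Cons_env del: upt_Suc)
  then have *: "recursive (\<lambda>e. rec_nat (A (\<lambda>i. e (Suc i))) (\<lambda>k r. B k r (\<lambda>i. e (Suc i))) (e 0))"
    unfolding recursive_def by blast
  \<comment> \<open>Variable 0 still holds the number of rounds. Putting \<open>N\<close> in its
    place and shifting the other variables down removes it.\<close>
  have "recursive (\<lambda>e. rec_nat (A (\<lambda>i. (case Suc i of 0 \<Rightarrow> N | Suc j \<Rightarrow> (\<lambda>e. e j)) e))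
      (\<lambda>k r. B k r (\<lambda>i. (case Suc i of 0 \<Rightarrow> N | Suc j \<Rightarrow> (\<lambda>e. e j)) e))
      ((case 0 of 0 \<Rightarrow> N | Suc j \<Rightarrow> (\<lambda>e. e j)) e))"
    by (rule recursive_subst[OF *, of "\<lambda>i. case i of 0 \<Rightarrow> N | Suc j \<Rightarrow> (\<lambda>e. e j)"])
       (auto intro: N recursive_var split: nat.split)
  then show ?thesis by simp
qed

text \<open>The truth value serves as the number of rounds of a recursion: none leaves
  \<open>b\<close>, one overwrites it by \<open>a\<close>.\<close>

lemma recursive_if:
  assumes "decidable P" "recursive a" "recursive b"
  shows "recursive (\<lambda>e. if P e then a e else b e)"
proof -
  have "recursive (\<lambda>e. rec_nat (b e) (\<lambda>k r. a e) (if P e then 1 else 0))"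
    by (rule recursive_rec_nat)
       (use assms recursive_subst[OF assms(2), of "\<lambda>i e. e (Suc (Suc i))"] in
         \<open>auto simp: decidable_def intro: recursive_var\<close>)
  moreover have "rec_nat (b e) (\<lambda>k r. a e) (if P e then 1 else 0) = (if P e then a e else b e)" for e
    by simp
  ultimately show ?thesis by simp
qed

lemma recursive_add:
  assumes "recursive a" "recursive b" shows "recursive (\<lambda>e. a e + b e)"
proof (rule recursive_app2[OF _ assms])
  have "recursive (\<lambda>e. rec_nat (e 0) (\<lambda>k r. Suc r) (e 1))"
    by (intro recursive_rec_nat recursive_var recursive_Suc)
  moreover have "rec_nat x (\<lambda>k r. Suc r) y = x + y" for x y :: nat by (induction y) auto
  ultimately show "recursive (\<lambda>e. e 0 + e 1)" by simp
qed

lemma recursive_mult: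
  assumes "recursive a" "recursive b" shows "recursive (\<lambda>e. a e * b e)"
proof (rule recursive_app2[OF _ assms])
  have "recursive (\<lambda>e. rec_nat 0 (\<lambda>k r. r + e 0) (e 1))"
    by (intro recursive_rec_nat recursive_var recursive_add recursive_zero)
  moreover have "rec_nat 0 (\<lambda>k r. r + x) y = x * y" for x y :: nat by (induction y) auto
  ultimately show "recursive (\<lambda>e. e 0 * e 1)" by simp
qed

lemma recursive_power:
  assumes "recursive a" "recursive b" shows "recursive (\<lambda>e. a e ^ b e)"
proof (rule recursive_app2[OF _ assms])
  have "recursive (\<lambda>e. rec_nat 1 (\<lambda>k r. r * e 0) (e 1))"
    by (intro recursive_rec_nat recursive_var recursive_mult recursive_const)
  moreover have "rec_nat 1 (\<lambda>k r. r * x) y = x ^ y" for x y :: nat by (induction y) auto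
  ultimately show "recursive (\<lambda>e. e 0 ^ e 1)" by simp
qed

lemma recursive_diff:
  assumes "recursive a" "recursive b" shows "recursive (\<lambda>e. a e - b e)"
proof (rule recursive_app2[OF _ assms])
  have "recursive (\<lambda>e. rec_nat 0 (\<lambda>k r. k) (e 0))"
    by (intro recursive_rec_nat recursive_var recursive_zero)
  moreover have "rec_nat 0 (\<lambda>k r. k) x = x - 1" for x :: nat by (cases x) auto
  ultimately have pred: "recursive (\<lambda>e. e 0 - 1)" by simp
  have "recursive (\<lambda>e. rec_nat (e 0) (\<lambda>k r. r - 1) (e 1))"
    by (intro recursive_rec_nat recursive_var recursive_app1[OF pred])
  moreover have "rec_nat x (\<lambda>k r. r - 1) y = x - y" for x y :: nat by (induction y) auto
  ultimately show "recursive (\<lambda>e. e 0 - e 1)" by simp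
qed

lemma recursive_sum:
  assumes "recursive (\<lambda>e. F (e 0) (\<lambda>i. e (Suc i)))" "recursive N"
  shows "recursive (\<lambda>e. \<Sum>k<N e. F k e)"
proof -
  \<comment> \<open>In the recursion below, variable 1 is the accumulator, which the summand must
    skip.\<close>
  have *: "recursive (\<lambda>e. F (e 0) (\<lambda>i. e (Suc (Suc i))))"
  proof -
    have "recursive (\<lambda>e. if i = 0 then e 0 else e (Suc i))" for i
      by (cases i) (auto intro: recursive_var)
    from recursive_subst[OF assms(1), of "\<lambda>i e. if i = 0 then e 0 else e (Suc i)", OF this]
    show ?thesis by simp
  qed
  have "recursive (\<lambda>e. rec_nat 0 (\<lambda>k r. r + F k e) (N e))"
    by (intro recursive_rec_nat recursive_var recursive_zero recursive_add * assms(2))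
  moreover have "rec_nat 0 (\<lambda>k r. r + F k e) n = (\<Sum>k<n. F k e)" for e and n :: nat
    by (induction n) auto
  ultimately show ?thesis by simp
qed

section \<open>Decidable predicates, bounded quantifiers and minimisation\<close>

lemma decidable_le:
  assumes "recursive a" "recursive b" shows "decidable (\<lambda>e. a e \<le> b e)"
proof -
  have "recursive (\<lambda>e. 1 - (a e - b e))"
    by (intro recursive_diff recursive_const assms)
  moreover have "1 - (a e - b e) = (if a e \<le> b e then 1 else 0)" for e by auto
  ultimately show ?thesis unfolding decidable_def by simp
qed

lemma decidable_not:
  assumes "decidable P" shows "decidable (\<lambda>e. \<not> P e)"
proof -
  have "(if P e then 0 else 1) = (if \<not> P e then 1 else (0::nat))" for e by simp
  with recursive_if[OF assms recursive_const[of 0] recursive_const[of 1]] show ?thesis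
    unfolding decidable_def by simp
qed

lemma decidable_conj:
  assumes "decidable P" "decidable Q" shows "decidable (\<lambda>e. P e \<and> Q e)"
proof -
  have "recursive (\<lambda>e. if P e then (if Q e then 1 else 0) else 0)"
    by (intro recursive_if recursive_const assms)
  moreover have "(if P e then (if Q e then 1 else 0) else 0) = (if P e \<and> Q e then 1 else (0::nat))" for e
    by simp
  ultimately show ?thesis unfolding decidable_def by simp
qed

lemma decidable_disj:
  assumes "decidable P" "decidable Q" shows "decidable (\<lambda>e. P e \<or> Q e)"
  using decidable_not[OF decidable_conj[OF decidable_not[OF assms(1)] decidable_not[OF assms(2)]]]
  by simp

lemma decidable_imp:
  assumes "decidable P" "decidable Q" shows "decidable (\<lambda>e. P e \<longrightarrow> Q e)"
  unfolding imp_conv_disj by (rule decidable_disj[OF decidable_not[OF assms(1)] assms(2)])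

lemma decidable_less:
  assumes "recursive a" "recursive b" shows "decidable (\<lambda>e. a e < b e)"
  using decidable_not[OF decidable_le[OF assms(2,1)]] by (simp add: not_le)

lemma decidable_eq:
  assumes "recursive a" "recursive b" shows "decidable (\<lambda>e. a e = b e)"
  using decidable_conj[OF decidable_le[OF assms] decidable_le[OF assms(2,1)]]
  by (simp add: eq_iff)

text \<open>A witness below the bound exists iff the number of witnesses, a bounded sum, is
  positive.\<close>

lemma decidable_ex_less:
  assumes "decidable (\<lambda>e. P (e 0) (\<lambda>i. e (Suc i)))" "recursive N"
  shows "decidable (\<lambda>e. \<exists>k<N e. P k e)"
proof -
  have "decidable (\<lambda>e. 0 < (\<Sum>k<N e. if P k e then 1 else 0 :: nat))"
    by (rule decidable_less, rule recursive_const, rule recursive_sum,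
      rule assms(1)[unfolded decidable_def], rule assms(2))
  moreover have "0 < (\<Sum>k<n. if P k e then 1 else 0 :: nat) \<longleftrightarrow> (\<exists>k<n. P k e)" for n e
    unfolding neq0_conv[symmetric] by auto
  ultimately show ?thesis by simp
qed

lemma decidable_all_less:
  assumes "decidable (\<lambda>e. P (e 0) (\<lambda>i. e (Suc i)))" "recursive N"
  shows "decidable (\<lambda>e. \<forall>k<N e. P k e)"
  using decidable_not[OF decidable_ex_less[OF decidable_not[OF assms(1)] assms(2)]] by simp

text \<open>The operator \<open>minimise\<close> looks for a zero, hence the indicator of the
  negation. The hypothesis \<open>ex\<close> for all environments supplies the totality that it
  demands.\<close>

lemma recursive_Least:
  assumes P: "decidable (\<lambda>e. P (e 0) (\<lambda>i. e (Suc i)))" and ex: "\<And>e. \<exists>k. P k e"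
  shows "recursive (\<lambda>e. LEAST k. P k e)"
proof -
  obtain n where "recursive_in n (\<lambda>e. if \<not> P (e 0) (\<lambda>i. e (Suc i)) then 1 else 0)"
    using decidable_not[OF P] unfolding decidable_def recursive_def by blast
  \<comment> \<open>A positive arity guarantees a first argument over which to minimise.\<close>
  then have "recursive_in (Suc n) (\<lambda>e. if \<not> P (e 0) (\<lambda>i. e (Suc i)) then 1 else 0)"
    by (rule recursive_in_mono) simp
  then obtain f where f: "total_recursive (Suc n) f"
    "\<And>e. (if \<not> P (e 0) (\<lambda>i. e (Suc i)) then 1 else 0) = f (map e [0..<Suc n])"
    unfolding recursive_in_def by blast
  have f_eq: "f (k # map e [0..<n]) = (if \<not> P k e then 1 else 0)" for k e
    using f(2)[of "\<lambda>i. case i of 0 \<Rightarrow> k | Suc i \<Rightarrow> e i"] by (simp add: map_Cons_env del: upt_Suc)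
  have "\<exists>k. f (k # xs) = 0" if "length xs = n" for xs
  proof -
    obtain k where "P k ((!) xs)" using ex by blast
    then have "f (k # xs) = 0" using f_eq[of k "(!) xs"] map_env_nth[OF that] by simp
    then show ?thesis ..
  qed
  then have "total_recursive n (\<lambda>xs. LEAST k. f (k # xs) = 0)"
    by (intro total_recursive.minimise f) auto
  then have "recursive_in n (\<lambda>e. LEAST k. P k e)"
    unfolding recursive_in_def by (rule_tac exI, rule_tac conjI) (auto simp: f_eq)
  then show ?thesis unfolding recursive_def by blast
qed

section \<open>Agreement with computable functions and relations\<close>

lemma computable_fun_iff_recursive: "computable_fun h \<longleftrightarrow> recursive (\<lambda>e. h (e 0))"
proof
  assume "computable_fun h"
  then obtain f where "total_recursive 1 f" "\<And>x. f [x] = h x"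
    unfolding computable_fun_def by blast
  then have "recursive_in 1 (\<lambda>e. h (e 0))"
    unfolding recursive_in_def by (intro exI[of _ f]) auto
  then show "recursive (\<lambda>e. h (e 0))" unfolding recursive_def by blast
next
  assume "recursive (\<lambda>e. h (e 0))"
  then obtain n where "recursive_in n (\<lambda>e. h (e 0))" unfolding recursive_def by blast
  then have "recursive_in (Suc n) (\<lambda>e. h (e 0))" by (rule recursive_in_mono) simp
  then obtain f where f: "total_recursive (Suc n) f" "\<And>e. h (e 0) = f (map e [0..<Suc n])"
    unfolding recursive_in_def by blast
  \<comment> \<open>The witness may have any positive arity; the arguments after the first are
    filled with 0.\<close>
  have "recursive_in 1 (\<lambda>e. f (map (\<lambda>i. (if i = 0 then (\<lambda>e. e 0) else (\<lambda>e. 0)) e) [0..<Suc n]))"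
  proof (rule recursive_in_comp[OF f(1)])
    have "recursive_in 1 (\<lambda>e. 0)"
      unfolding recursive_in_def using total_recursive.zero by blast
    then show "recursive_in 1 (if i = 0 then \<lambda>e. e 0 else (\<lambda>e. 0))" for i :: nat
      using recursive_in_var[of 0 1] by simp
  qed
  also have "(\<lambda>e. f (map (\<lambda>i. (if i = 0 then (\<lambda>e. e 0) else (\<lambda>e. 0)) e) [0..<Suc n])) = (\<lambda>e. h (e 0))"
    by (rule ext) (simp add: f(2)[of "\<lambda>i. (if i = 0 then (\<lambda>e. e 0) else (\<lambda>e. 0)) e" for e, symmetric]
      del: upt_Suc)
  finally obtain g where g: "total_recursive 1 g" "\<And>e. h (e 0) = g (map e [0..<1])"
    unfolding recursive_in_def by blast
  have "g [x] = h x" for x using g(2)[of "\<lambda>_. x"] by simp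
  with g(1) show "computable_fun h" unfolding computable_fun_def by blast
qed

lemma computable_rel_imp_decidable:
  assumes "computable_rel R" shows "decidable (\<lambda>e. (e 0, e 1) \<in> R)"
proof -
  obtain f where f: "total_recursive 2 f" "\<And>x y. f [x, y] = (if (x, y) \<in> R then 1 else 0)"
    using assms unfolding computable_rel_def by blast
  have "map e [0..<2] = [e 0, e 1]" for e :: "nat \<Rightarrow> nat"
    by (simp add: upt_rec)
  with f have "recursive_in 2 (\<lambda>e. if (e 0, e 1) \<in> R then 1 else 0)"
    unfolding recursive_in_def by (intro exI[of _ f]) auto
  then show ?thesis unfolding decidable_def recursive_def by blast
qed

section \<open>Division and the coding of pairs and finite sets\<close>

lemma recursive_div:
  assumes "recursive a" "recursive b" shows "recursive (\<lambda>e. a e div b e)"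
proof (rule recursive_app2[OF _ assms])
  \<comment> \<open>The quotient counts the \<open>q\<close> with \<open>Suc q * y \<le> x\<close>.
    For \<open>y = 0\<close> this count would be \<open>x\<close>, while
    \<open>x div 0 = 0\<close>.\<close>
  have "recursive (\<lambda>e. if 0 < e 1 then \<Sum>q<e 0. if Suc q * e 1 \<le> e 0 then 1 else 0 else 0)"
    by (intro recursive_if recursive_sum recursive_const recursive_var recursive_Suc recursive_mult
      decidable_le decidable_less)
  moreover have "(if 0 < y then \<Sum>q<x. if Suc q * y \<le> x then 1 else 0 else 0) = x div y" for x y :: nat
  proof (cases "y = 0")
    case False
    have "q \<in> {q. q < x \<and> Suc q * y \<le> x} \<longleftrightarrow> q \<in> {..<x div y}" for q
    proof -
      have "q < x div y \<longleftrightarrow> Suc q * y \<le> x"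
        using False by (simp add: Suc_le_eq[symmetric] less_eq_div_iff_mult_less_eq del: mult_Suc)
      moreover have "x div y \<le> x" by simp
      ultimately show ?thesis by (auto intro: order.strict_trans2)
    qed
    then have "{q. q < x \<and> Suc q * y \<le> x} = {..<x div y}" by blast
    then show ?thesis using False
      by (simp add: sum.If_cases Int_def del: mult_Suc)
  qed simp
  ultimately show "recursive (\<lambda>e. e 0 div e 1)" by (simp only:)
qed

lemma decidable_odd:
  assumes "recursive a" shows "decidable (\<lambda>e. odd (a e))"
proof -
  have "decidable (\<lambda>e. \<not> (2 * (a e div 2) = a e))"
    by (intro decidable_not decidable_eq recursive_mult recursive_div recursive_const assms)
  moreover have "\<not> (2 * (x div 2) = x) \<longleftrightarrow> odd x" for x :: nat by (metis dvd_mult_div_cancel dvd_triv_left)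
  ultimately show ?thesis by simp
qed

lemma decidable_mem_set_decode:
  assumes "recursive a" "recursive b" shows "decidable (\<lambda>e. a e \<in> set_decode (b e))"
  unfolding set_decode_def mem_Collect_eq
  by (intro decidable_odd recursive_div recursive_power recursive_const assms)

lemma recursive_prod_encode:
  assumes "recursive a" "recursive b" shows "recursive (\<lambda>e. prod_encode (a e, b e))"
  unfolding prod_encode_def triangle_def prod.case
  by (intro recursive_div recursive_add recursive_mult recursive_Suc recursive_const assms)

lemmas recursive_intros = recursive_var recursive_const recursive_Suc recursive_add recursive_mult
  recursive_power recursive_diff recursive_div recursive_sum recursive_if recursive_prod_encode
  decidable_le decidable_less decidable_eq decidable_not decidable_conj decidable_disj decidable_imp
  decidable_ex_less decidable_all_less decidable_mem_set_decode

section \<open>The marriage theorem\<close>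

text \<open>Induction in the style of Halmos and Vaughan. If some proper non-empty \<open>J\<close>
  is tight, it is matched first and its neighbours are removed. Otherwise every proper non-empty set
  has a neighbour to spare, so one arbitrary pair can be matched and its element removed.\<close>

theorem Hall_marriage:
  fixes A :: "'i \<Rightarrow> 'b set"
  assumes "finite I" and "\<And>i. i \<in> I \<Longrightarrow> finite (A i)"
    and "\<And>J. J \<subseteq> I \<Longrightarrow> card J \<le> card (\<Union>(A ` J))"
  shows "\<exists>f. inj_on f I \<and> (\<forall>i\<in>I. f i \<in> A i)"
  using assms
proof (induction "card I" arbitrary: I A rule: less_induct)
  case less
  note fin = less.prems(1) and finA = less.prems(2) and hall = less.prems(3)
  have finU: "finite (\<Union>(A ` J))" if "J \<subseteq> I" for J
    using that finA fin by (meson finite_UN finite_subset subsetD)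
  show ?case
  proof (cases "\<exists>J. J \<subset> I \<and> J \<noteq> {} \<and> card (\<Union>(A ` J)) \<le> card J")
    case True
    then obtain J where J: "J \<subset> I" "J \<noteq> {}" "card (\<Union>(A ` J)) \<le> card J" by blast
    have finJ: "finite J" using J(1) fin finite_subset by blast
    have "\<exists>f. inj_on f J \<and> (\<forall>i\<in>J. f i \<in> A i)"
    proof (rule less.hyps)
      show "card J < card I" using J(1) fin by (rule psubset_card_mono[rotated])
      show "card L \<le> card (\<Union>(A ` L))" if "L \<subseteq> J" for L using that J(1) by (intro hall) auto
    qed (use J(1) finJ finA in auto)
    then obtain f where f: "inj_on f J" "\<And>i. i \<in> J \<Longrightarrow> f i \<in> A i" by blast
    define U where "U = \<Union>(A ` J)"
    have finUJ: "finite U" unfolding U_def using finU J(1) by auto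
    have cardI: "card (I - J) < card I"
      using J by (intro psubset_card_mono[OF fin]) auto
    have "\<exists>g. inj_on g (I - J) \<and> (\<forall>i\<in>I - J. g i \<in> A i - U)"
    proof (rule less.hyps[OF cardI])
      fix L assume L: "L \<subseteq> I - J"
      \<comment> \<open>The condition for \<open>L \<union> J\<close> minus the tight one for
        \<open>J\<close> is the condition for \<open>L\<close> outside \<open>U\<close>.\<close>
      have "card (L \<union> J) \<le> card (\<Union>(A ` (L \<union> J)))"
        using L J(1) by (intro hall) blast
      also have "\<Union>(A ` (L \<union> J)) = \<Union>((\<lambda>i. A i - U) ` L) \<union> U"
        unfolding U_def by auto
      also have "card \<dots> \<le> card (\<Union>((\<lambda>i. A i - U) ` L)) + card U"
        by (rule card_Un_le)
      also have "card U \<le> card J" using J(3) U_def by simp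
      also have "card (L \<union> J) = card L + card J"
        using L finJ fin finite_subset[of L I] by (intro card_Un_disjoint) auto
      finally show "card L \<le> card (\<Union>((\<lambda>i. A i - U) ` L))" by simp
    qed (use fin finA in auto)
    then obtain g where g: "inj_on g (I - J)" "\<And>i. i \<in> I - J \<Longrightarrow> g i \<in> A i - U" by blast
    define h where "h i = (if i \<in> J then f i else g i)" for i
    have fU: "f i \<in> U" if "i \<in> J" for i using f(2) that U_def by blast
    have "inj_on h I"
    proof (rule inj_onI)
      fix i j assume ij: "i \<in> I" "j \<in> I" "h i = h j"
      have gU: "g k \<notin> U" if "k \<in> I" "k \<notin> J" for k using g(2) that by blast
      have "i \<in> J \<longleftrightarrow> j \<in> J" using fU[of i] fU[of j] gU[of i] gU[of j] ij by (auto simp: h_def split: if_splits)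
      then show "i = j" using ij f(1) g(1) by (auto simp: h_def inj_on_def split: if_splits)
    qed
    moreover have "\<forall>i\<in>I. h i \<in> A i" using f(2) g(2) by (auto simp: h_def)
    ultimately show ?thesis by blast
  next
    case False
    have slack: "card J < card (\<Union>(A ` J))" if "J \<subset> I" "J \<noteq> {}" for J
      using False that not_le by blast
    show ?thesis
    proof (cases "I = {}")
      case False
      then obtain i where i: "i \<in> I" by blast
      have "card {i} \<le> card (A i)" using hall[of "{i}"] i by simp
      then have "A i \<noteq> {}" by auto
      then obtain x where x: "x \<in> A i" by blast
      have "\<exists>g. inj_on g (I - {i}) \<and> (\<forall>j\<in>I - {i}. g j \<in> A j - {x})"
      proof (rule less.hyps)
        show "card (I - {i}) < card I" by (rule card_Diff1_less[OF fin i])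
        fix L assume L: "L \<subseteq> I - {i}"
        show "card L \<le> card (\<Union>((\<lambda>i. A i - {x}) ` L))"
        proof (cases "L = {}")
          case False
          then have "card L < card (\<Union>(A ` L))"
            using L i slack[of L] by auto
          moreover have "\<Union>((\<lambda>i. A i - {x}) ` L) = \<Union>(A ` L) - {x}" by auto
          ultimately show ?thesis by (simp add: card_Diff_singleton_if) linarith
        qed simp
      qed (use fin finA in auto)
      then obtain g where g: "inj_on g (I - {i})" "\<And>j. j \<in> I - {i} \<Longrightarrow> g j \<in> A j - {x}" by blast
      have "inj_on (g(i := x)) I"
        using g by (auto simp: inj_on_def)
      moreover have "\<forall>j\<in>I. (g(i := x)) j \<in> A j" using g(2) x by auto
      ultimately show ?thesis by blast
    qed simp
  qed
qed

text \<open>Each index is replaced by \<open>k\<close> clones with the same candidates; a set of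
  clones is at most \<open>k\<close> times as large as its projection.\<close>

lemma Hall_marriage_multi:
  fixes A :: "'i \<Rightarrow> 'b set"
  assumes I: "finite I" and A: "\<And>i. i \<in> I \<Longrightarrow> finite (A i)"
    and hall: "\<And>J. J \<subseteq> I \<Longrightarrow> k * card J \<le> card (\<Union>(A ` J))"
  shows "\<exists>c. inj_on c (I \<times> {..<k}) \<and> (\<forall>i\<in>I. \<forall>j<k. c (i, j) \<in> A i)"
proof -
  have "\<exists>c. inj_on c (I \<times> {..<k}) \<and> (\<forall>p\<in>I \<times> {..<k}. c p \<in> A (fst p))"
  proof (rule Hall_marriage)
    fix J assume J: "J \<subseteq> I \<times> {..<k}"
    have finJ: "finite (fst ` J)" using J I finite_subset[of J] by auto
    have "J \<subseteq> fst ` J \<times> {..<k}" using J by force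
    then have "card J \<le> card (fst ` J \<times> {..<k})" using finJ by (intro card_mono) auto
    also have "\<dots> = k * card (fst ` J)" by (simp add: card_cartesian_product)
    also have "\<dots> \<le> card (\<Union>(A ` (fst ` J)))" using J by (intro hall) auto
    finally show "card J \<le> card (\<Union>((\<lambda>p. A (fst p)) ` J))" by (simp add: image_image)
  qed (use I A in auto)
  then show ?thesis by fastforce
qed

section \<open>Labelled forests\<close>

definition inv_letter :: "nat \<Rightarrow> nat" where
  "inv_letter t = (t + 2) mod 4"

text \<open>An edge \<open>(d, y, t, z)\<close> makes \<open>z\<close> the child of \<open>y\<close> reached by the letter \<open>t\<close>; the rank \<open>d\<close>
  grows strictly along descending paths and so rules out cycles and infinite ascending paths.\<close>

definition labelled_forest :: "(nat \<times> 'a \<times> nat \<times> 'a) set \<Rightarrow> bool" where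
  "labelled_forest S \<longleftrightarrow> (\<forall>d y t z. (d, y, t, z) \<in> S \<longrightarrow> t < 4 \<and>
     (\<forall>d' y' t'. (d', y', t', z) \<in> S \<longrightarrow> d' = d \<and> y' = y \<and> t' = t) \<and>
     (\<forall>d' y' t'. (d', y', t', y) \<in> S \<longrightarrow> d' < d \<and> t \<noteq> inv_letter t') \<and>
     (\<forall>d' z'. (d', y, t, z') \<in> S \<longrightarrow> z' = z))"

text \<open>An edge is stored once, pointing away from the root; it can be walked downwards by its
  label and upwards by the inverse letter.\<close>

definition move :: "(nat \<times> 'a \<times> nat \<times> 'a) set \<Rightarrow> nat \<Rightarrow> 'a \<Rightarrow> 'a \<Rightarrow> bool" where
  "move S t y z \<longleftrightarrow> (\<exists>d. (d, y, t, z) \<in> S \<or> (d, z, inv_letter t, y) \<in> S)"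

definition saturated :: "(nat \<times> 'a \<times> nat \<times> 'a) set \<Rightarrow> 'a \<Rightarrow> bool" where
  "saturated S y \<longleftrightarrow> (\<forall>t<4. \<exists>z. move S t y z)"

lemma less_4_cases: "t < 4 \<Longrightarrow> t = 0 \<or> t = 1 \<or> t = 2 \<or> t = (3::nat)"
  by auto

lemma inv_letter_inv [simp]: "t < 4 \<Longrightarrow> inv_letter (inv_letter t) = t"
  by (drule less_4_cases) (auto simp: inv_letter_def)

lemma inv_letter_less [simp]: "inv_letter t < 4"
  by (simp add: inv_letter_def)

lemma inv_letter_eq_iff [simp]:
  assumes "s < 4" "t < 4" shows "inv_letter s = inv_letter t \<longleftrightarrow> s = t"
  by (metis assms inv_letter_inv)

lemma labelled_forestD:
  assumes "labelled_forest S" "(d, y, t, z) \<in> S"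
  shows "t < 4"
    and "(d', y', t', z) \<in> S \<Longrightarrow> d' = d \<and> y' = y \<and> t' = t"
    and "(d', y', t', y) \<in> S \<Longrightarrow> d' < d"
    and "(d', y', t', y) \<in> S \<Longrightarrow> t \<noteq> inv_letter t'"
    and "(d', y, t, z') \<in> S \<Longrightarrow> z' = z"
  using assms unfolding labelled_forest_def by blast+

lemma move_inv: "t < 4 \<Longrightarrow> move S (inv_letter t) z y \<longleftrightarrow> move S t y z"
  unfolding move_def by auto

text \<open>Children of a vertex have distinct labels, its parent is unique, and no child carries
  the letter that leads back to the parent.\<close>

lemma move_functional:
  assumes S: "labelled_forest S" and t: "t < 4" and m: "move S t y z" "move S t y z'"
  shows "z' = z"
proof -
  have False if "(d, y, t, u) \<in> S" "(d', u', inv_letter t, y) \<in> S" for d u d' u'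
    using labelled_forestD(4)[OF S that] t by simp
  then show ?thesis
    using m labelled_forestD(2)[OF S] labelled_forestD(5)[OF S] unfolding move_def by blast
qed

lemma saturated_mono: "saturated S y \<Longrightarrow> S \<subseteq> S' \<Longrightarrow> saturated S' y"
  unfolding saturated_def move_def by blast

section \<open>Reduced words acting on a forest\<close>

definition reduced_letters :: "nat list \<Rightarrow> bool" where
  "reduced_letters w \<longleftrightarrow> successively (\<lambda>s t. s \<noteq> inv_letter t) w"

locale forest_action =
  fixes S :: "(nat \<times> 'a \<times> nat \<times> 'a) set" and act :: "nat \<Rightarrow> 'a \<Rightarrow> 'a"
  assumes forest: "labelled_forest S" and act: "t < 4 \<Longrightarrow> move S t y (act t y)"
begin

lemma act_eqI: "t < 4 \<Longrightarrow> move S t y z \<Longrightarrow> act t y = z"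
  using move_functional[OF forest] act by blast

lemma act_inv [simp]: "t < 4 \<Longrightarrow> act (inv_letter t) (act t y) = y"
  by (rule act_eqI) (simp_all add: move_inv act)

lemma act_inv' [simp]: "t < 4 \<Longrightarrow> act t (act (inv_letter t) y) = y"
  using act_inv[of "inv_letter t" y] by simp

text \<open>The first step from a root can only go down. After a downward step the only way up
  undoes that step, which a reduced word never does. Since \<open>foldr\<close> applies the last
  letter first, \<open>hd w\<close> labels the last edge walked.\<close>

lemma descend_from_root:
  assumes root: "\<And>d y t. (d, y, t, x) \<notin> S"
    and w: "w \<noteq> []" "set w \<subseteq> {..<4}" "reduced_letters w"
  shows "\<exists>d y. (d, y, hd w, foldr act w x) \<in> S"
  using w
proof (induction w)
  case (Cons t w)
  let ?p = "foldr act w x"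
  have t: "t < 4" using Cons.prems by simp
  have m: "move S t ?p (act t ?p)" by (rule act[OF t])
  show ?case
  proof (cases w)
    case Nil
    then show ?thesis using m root by (auto simp: move_def)
  next
    case (Cons s u)
    have s: "s < 4" and ts: "t \<noteq> inv_letter s"
      using Cons.prems Cons by (auto simp: reduced_letters_def)
    obtain d y where dy: "(d, y, s, ?p) \<in> S"
      using Cons.IH Cons.prems Cons by (auto simp: reduced_letters_def)
    have "(d', act t ?p, inv_letter t, ?p) \<notin> S" for d'
      using labelled_forestD(2)[OF forest dy, of d' "act t ?p" "inv_letter t"] ts t by auto
    then show ?thesis using m by (auto simp: move_def)
  qed
qed simp

text \<open>If \<open>x = s y\<close> with \<open>y\<close> the parent of \<open>x\<close>, then a word fixing \<open>x\<close> is conjugated by \<open>s\<close> to a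
  reduced word fixing \<open>y\<close>, which is still non-empty.\<close>

lemma no_fixed_point:
  assumes "w \<noteq> []" "set w \<subseteq> {..<4}" "reduced_letters w"
  shows "foldr act w x \<noteq> x"
proof -
  \<comment> \<open>Roots get 0 and any other vertex the successor of the rank of its unique parent
    edge; the successor keeps children of roots above roots.\<close>
  define rank where "rank x = (if \<exists>d y t. (d, y, t, x) \<in> S
    then Suc (THE d. \<exists>y t. (d, y, t, x) \<in> S) else 0)" for x
  have rank_child: "rank x = Suc d" if "(d, y, t, x) \<in> S" for d y t x
  proof -
    have "(THE d. \<exists>y t. (d, y, t, x) \<in> S) = d"
      using labelled_forestD(2)[OF forest that] that by blast
    then show ?thesis using that by (auto simp: rank_def)
  qed
  show ?thesis
    using assms
  proof (induction "rank x" arbitrary: x w rule: less_induct)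
    case less
    note w = less.prems
    show ?case
    proof (cases "\<exists>d y s. (d, y, s, x) \<in> S")
      case False
      then show ?thesis using descend_from_root[of x w] w by metis
    next
      case True
      then obtain d y s where e: "(d, y, s, x) \<in> S" by blast
      have s: "s < 4" by (rule labelled_forestD(1)[OF forest e])
      have x: "x = act s y" using act_eqI[OF s, of y x] e by (auto simp: move_def)
      have y: "act (inv_letter s) x = y" using x s by simp
      have "rank y < rank x"
      proof (cases "\<exists>d' y' t'. (d', y', t', y) \<in> S")
        case True
        then obtain d' y' t' where "(d', y', t', y) \<in> S" by blast
        then show ?thesis using rank_child e labelled_forestD(3)[OF forest e] by simp
      next
        case False
        then show ?thesis using rank_child[OF e] by (simp add: rank_def)
      qed
      note IH = less.hyps[OF this]
      show ?thesis
      proof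
        assume fx: "foldr act w x = x"
        \<comment> \<open>The conjugate \<open>inv_letter s # w @ [s]\<close> fixes
          \<open>y\<close>. It may cancel at the front, when \<open>hd w = s\<close>, and at the
          back, when \<open>last w = inv_letter s\<close>. The four cases take the cancelled
          word.\<close>
        show False
        proof (cases "hd w = s")
          case True
          then obtain u where wu: "w = s # u" using w(1) by (cases w) auto
          have ux: "foldr act u x = y"
            using arg_cong[OF fx, of "act (inv_letter s)"] wu s y by simp
          show False
          proof (cases "u \<noteq> [] \<and> last u = inv_letter s")
            case True
            then obtain v where uv: "u = v @ [inv_letter s]" by (metis append_butlast_last_id)
            \<comment> \<open>For empty \<open>v\<close> the word \<open>w\<close> would be
              \<open>s\<close> followed by its inverse, which is not reduced.\<close>
            have "v \<noteq> []" using w(3) wu uv s by (auto simp: reduced_letters_def)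
            moreover have "foldr act v y = y" using ux uv y by simp
            ultimately show False using IH[of v] w wu uv
              by (auto simp: reduced_letters_def successively_append_iff successively_Cons)
          next
            case False
            have "foldr act (u @ [s]) y = y" using ux x by simp
            then show False using IH[of "u @ [s]"] w wu False s
              by (auto simp: reduced_letters_def successively_append_iff successively_Cons)
          qed
        next
          case hd: False
          show False
          proof (cases "last w = inv_letter s")
            case True
            then obtain v where wv: "w = v @ [inv_letter s]" using w(1) by (metis append_butlast_last_id)
            have "foldr act (inv_letter s # v) y = y" using fx wv y by simp
            moreover have "inv_letter s \<noteq> inv_letter (hd v)" if "v \<noteq> []"
              using that hd wv w(2) s hd_in_set[OF that] by (auto simp: subset_iff)
            ultimately show False using IH[of "inv_letter s # v"] w wv
              by (auto simp: reduced_letters_def successively_append_iff successively_Cons)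
          next
            case False
            have "foldr act (inv_letter s # w @ [s]) y = y" using fx x y by simp
            moreover have "inv_letter s \<noteq> inv_letter (hd w)"
              using hd w(1,2) s hd_in_set[OF w(1)] by (auto simp: subset_iff)
            ultimately show False using IH[of "inv_letter s # w @ [s]"] w False s
              by (auto simp: reduced_letters_def successively_append_iff successively_Cons)
          qed
        qed
      qed
    qed
  qed
qed

end

section \<open>Completing one vertex, then a block of vertices\<close>

definition vertices :: "(nat \<times> 'a \<times> nat \<times> 'a) set \<Rightarrow> 'a set" where
  "vertices S = {v. \<exists>d t u. (d, v, t, u) \<in> S \<or> (d, u, t, v) \<in> S}"

text \<open>Having no children yet, \<open>y\<close> lacks every letter except possibly the one
  leading to its parent. Fresh vertices as new children cannot create a second parent or a
  cycle.\<close>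

lemma add_vertex:
  fixes S :: "(nat \<times> 'a \<times> nat \<times> 'a) set" and k :: "nat \<Rightarrow> 'a"
  assumes S: "labelled_forest S" and fin: "finite S"
    and y: "\<And>d t z. (d, y, t, z) \<notin> S"
    and k: "inj_on k {..<4}" "\<And>t. t < 4 \<Longrightarrow> k t \<notin> vertices S" "\<And>t. t < 4 \<Longrightarrow> k t \<noteq> y"
  shows "\<exists>S'. S \<subseteq> S' \<and> finite S' \<and> labelled_forest S' \<and> saturated S' y \<and>
    (\<forall>d u t z. (d, u, t, z) \<in> S' \<longrightarrow> (d, u, t, z) \<notin> S \<longrightarrow> u = y \<and> z \<in> k ` {..<4})"
proof -
  \<comment> \<open>A rank above all existing ones exceeds that of the edge into \<open>y\<close>,
    if there is one.\<close>
  define D where "D = Suc (Max (insert 0 (fst ` S)))"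
  have D: "d < D" if "(d, u, t, z) \<in> S" for d u t z
  proof -
    have "d \<in> insert 0 (fst ` S)" using that by force
    then show ?thesis unfolding D_def using fin by (simp add: le_imp_less_Suc)
  qed
  \<comment> \<open>The missing letters: an edge into \<open>y\<close> labelled
    \<open>inv_letter t\<close> already realises \<open>t\<close> by going up.\<close>
  define T where "T = {t. t < 4 \<and> \<not> (\<exists>d' y'. (d', y', inv_letter t, y) \<in> S)}"
  define S' where "S' = S \<union> (\<lambda>t. (D, y, t, k t)) ` T"
  have T4: "t < 4" if "t \<in> T" for t using that T_def by simp
  have mem: "(d, u, t, z) \<in> S' \<longleftrightarrow> (d, u, t, z) \<in> S \<or> d = D \<and> u = y \<and> t \<in> T \<and> z = k t" for d u t z
    unfolding S'_def by auto
  have kS: "(d, k t, s, z) \<notin> S" "(d, z, s, k t) \<notin> S" if "t \<in> T" for d t s z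
    using k(2)[OF T4[OF that]] unfolding vertices_def by auto
  have "labelled_forest S'"
    unfolding labelled_forest_def
  proof (intro allI impI)
    fix d u t z assume e: "(d, u, t, z) \<in> S'"
    have "t < 4" using e mem T4 labelled_forestD(1)[OF S] by blast
    moreover have "d' = d \<and> y' = u \<and> t' = t" if "(d', y', t', z) \<in> S'" for d' y' t'
    proof -
      have "t' = t" if "t \<in> T" "t' \<in> T" "k t' = k t" for t t'
        using that T4 k(1) by (auto simp: inj_on_def)
      then show ?thesis using e that mem kS labelled_forestD(2)[OF S] by metis
    qed
    moreover have "d' < d \<and> t \<noteq> inv_letter t'" if e': "(d', y', t', u) \<in> S'" for d' y' t'
    proof (cases "(d, u, t, z) \<in> S")
      case True
      then have "(d', y', t', u) \<in> S" using e' mem kS by metis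
      then show ?thesis using labelled_forestD(3,4)[OF S True] by blast
    next
      case False
      then have eq: "d = D" "u = y" "t \<in> T" "z = k t" using e mem by blast+
      then have "(d', y', t', y) \<in> S" using e' mem k(3) T4 by metis
      moreover from this have "t' < 4" by (rule labelled_forestD(1)[OF S])
      ultimately show ?thesis using D eq by (auto simp: T_def)
    qed
    moreover have "z' = z" if "(d', u, t, z') \<in> S'" for d' z'
      using e that mem y labelled_forestD(5)[OF S] by metis
    ultimately show "t < 4 \<and> (\<forall>d' y' t'. (d', y', t', z) \<in> S' \<longrightarrow> d' = d \<and> y' = u \<and> t' = t) \<and>
      (\<forall>d' y' t'. (d', y', t', u) \<in> S' \<longrightarrow> d' < d \<and> t \<noteq> inv_letter t') \<and>
      (\<forall>d' z'. (d', u, t, z') \<in> S' \<longrightarrow> z' = z)" by blast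
  qed
  moreover have "saturated S' y"
    unfolding saturated_def
  proof (intro allI impI)
    fix t :: nat assume "t < 4"
    then show "\<exists>z. move S' t y z"
      by (cases "t \<in> T") (auto simp: move_def mem T_def)
  qed
  moreover have "finite S'" unfolding S'_def T_def using fin by simp
  moreover have "S \<subseteq> S'" unfolding S'_def by blast
  moreover have "\<forall>d u t z. (d, u, t, z) \<in> S' \<longrightarrow> (d, u, t, z) \<notin> S \<longrightarrow> u = y \<and> z \<in> k ` {..<4}"
    using mem T4 by blast
  ultimately show ?thesis by (intro exI[of _ S'] conjI)
qed

text \<open>By injectivity the vertices of the block have on average at most one child inside the block,
  so some vertex has at most one; it can be added last.\<close>

lemma add_block:
  fixes S :: "(nat \<times> 'a \<times> nat \<times> 'a) set" and c :: "'a \<times> nat \<Rightarrow> 'a"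
  assumes "finite F" and c: "inj_on c (F \<times> {..<5})"
    and "labelled_forest S" "finite S"
    and "\<And>d y t z. y \<in> F \<Longrightarrow> (d, y, t, z) \<notin> S"
    and "\<And>y j. y \<in> F \<Longrightarrow> j < 5 \<Longrightarrow> c (y, j) \<notin> vertices S"
  shows "\<exists>S'. S \<subseteq> S' \<and> finite S' \<and> labelled_forest S' \<and> (\<forall>y\<in>F. saturated S' y) \<and>
    (\<forall>d u t z. (d, u, t, z) \<in> S' \<longrightarrow> (d, u, t, z) \<notin> S \<longrightarrow> u \<in> F \<and> (\<exists>j<5. z = c (u, j)))"
  using assms
proof (induction "card F" arbitrary: F)
  case 0
  then show ?case by auto
next
  case (Suc n)
  note F = \<open>finite F\<close> and c = \<open>inj_on c (F \<times> {..<5})\<close>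
  define I where "I y = {j. j < 5 \<and> c (y, j) \<in> F}" for y
  have finI: "finite (I y)" for y unfolding I_def by simp
  \<comment> \<open>Otherwise the disjoint families of candidates inside \<open>F\<close> would have
    at least \<open>2 * card F\<close> members in total.\<close>
  have "\<exists>y\<in>F. card (I y) \<le> 1"
  proof (rule ccontr)
    assume "\<not> (\<exists>y\<in>F. card (I y) \<le> 1)"
    then have "\<And>y. y \<in> F \<Longrightarrow> 2 \<le> card (I y)" by force
    then have "card F * 2 \<le> (\<Sum>y\<in>F. card (I y))" using sum_bounded_below[of F 2 "\<lambda>y. card (I y)"] by simp
    also have "\<dots> = card (SIGMA y:F. I y)" using F finI by simp
    also have "\<dots> = card (c ` (SIGMA y:F. I y))"
      by (rule card_image[symmetric], rule inj_on_subset[OF c]) (auto simp: I_def)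
    also have "\<dots> \<le> card F" by (rule card_mono[OF F]) (auto simp: I_def)
    finally show False using Suc.hyps(2) by simp
  qed
  then obtain y where y: "y \<in> F" "card (I y) \<le> 1" by blast
  have "card ({..<5} - I y) \<ge> 4"
  proof -
    have "I y \<subseteq> {..<5}" by (auto simp: I_def)
    then show ?thesis using y(2) card_Diff_subset[OF finI, of y "{..<5}"] by simp
  qed
  then obtain G where G: "G \<subseteq> {..<5} - I y" "card G = 4"
    using obtain_subset_with_card_n by metis
  then obtain g where g: "bij_betw g {..<4::nat} G"
    using ex_bij_betw_nat_finite[of G] by (metis card.infinite atLeast0LessThan zero_neq_numeral)
  have g5: "g t < 5" "c (y, g t) \<notin> F" if "t < 4" for t
    using that g G(1) bij_betwE[OF g] by (force simp: I_def)+
  have "\<exists>S'. S \<subseteq> S' \<and> finite S' \<and> labelled_forest S' \<and> (\<forall>y\<in>F - {y}. saturated S' y) \<and>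
    (\<forall>d u t z. (d, u, t, z) \<in> S' \<longrightarrow> (d, u, t, z) \<notin> S \<longrightarrow> u \<in> F - {y} \<and> (\<exists>j<5. z = c (u, j)))"
  proof (rule Suc.hyps(1))
    show "n = card (F - {y})" using Suc.hyps(2) y(1) F by simp
    show "inj_on c ((F - {y}) \<times> {..<5})" by (rule inj_on_subset[OF c]) auto
  qed (use Suc.prems in auto)
  then obtain S1 where S1: "S \<subseteq> S1" "finite S1" "labelled_forest S1" "\<forall>v\<in>F - {y}. saturated S1 v"
    and "\<forall>d u t z. (d, u, t, z) \<in> S1 \<longrightarrow> (d, u, t, z) \<notin> S \<longrightarrow> u \<in> F - {y} \<and> (\<exists>j<5. z = c (u, j))"
    by (elim exE conjE)
  then have new: "(d, u, t, z) \<in> S \<or> u \<in> F - {y} \<and> (\<exists>j<5. z = c (u, j))" if "(d, u, t, z) \<in> S1" for d u t z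
    using that by meson
  have kids: "c (y, j) \<noteq> c (u, i)" if "j < 5" "u \<in> F - {y}" "i < 5" for i j u
    using inj_onD[OF c, of "(y, j)" "(u, i)"] that y(1) by auto
  have "\<exists>S2. S1 \<subseteq> S2 \<and> finite S2 \<and> labelled_forest S2 \<and> saturated S2 y \<and> (\<forall>d u t z.
    (d, u, t, z) \<in> S2 \<longrightarrow> (d, u, t, z) \<notin> S1 \<longrightarrow> u = y \<and> z \<in> (\<lambda>t. c (y, g t)) ` {..<4})"
  proof (rule add_vertex[OF S1(3,2), of y "\<lambda>t. c (y, g t)"])
    show "(d, y, t, z) \<notin> S1" for d t z using new[of d y t z] Suc.prems y(1) by blast
    show "inj_on (\<lambda>t. c (y, g t)) {..<4}"
    proof (rule inj_onI)
      fix s t :: nat assume st: "s \<in> {..<4}" "t \<in> {..<4}" "c (y, g s) = c (y, g t)"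
      then have "g s = g t" using inj_onD[OF c, of "(y, g s)" "(y, g t)"] g5 y(1) by auto
      then show "s = t" using g st by (auto simp: bij_betw_def inj_on_def)
    qed
    fix t :: nat assume t: "t < 4"
    show "c (y, g t) \<noteq> y" using g5(2)[OF t] y(1) by auto
    \<comment> \<open>The vertices new in \<open>S1\<close> lie in \<open>F\<close> or are
      candidates of other vertices. The chosen candidates of \<open>y\<close> avoid the former by
      the choice of \<open>G\<close> and the latter by injectivity.\<close>
    have "c (y, g t) \<notin> vertices S" using Suc.prems(6) y(1) g5(1)[OF t] by blast
    then show "c (y, g t) \<notin> vertices S1"
      using new kids[OF g5(1)[OF t]] g5(2)[OF t] unfolding vertices_def by blast
  qed
  then obtain S2 where S2: "S1 \<subseteq> S2" "finite S2" "labelled_forest S2" "saturated S2 y"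
    and new': "\<forall>d u t z. (d, u, t, z) \<in> S2 \<longrightarrow> (d, u, t, z) \<notin> S1 \<longrightarrow>
      u = y \<and> z \<in> (\<lambda>t. c (y, g t)) ` {..<4}"
    by (elim exE conjE)
  have "saturated S2 v" if "v \<in> F" for v
    using that S2(4) S1(4) saturated_mono[OF _ S2(1)] by (cases "v = y") auto
  moreover have "u \<in> F \<and> (\<exists>j<5. z = c (u, j))" if e: "(d, u, t, z) \<in> S2" "(d, u, t, z) \<notin> S" for d u t z
  proof (cases "(d, u, t, z) \<in> S1")
    case True
    then show ?thesis using new e(2) by blast
  next
    case False
    then have "u = y" "z \<in> (\<lambda>t. c (y, g t)) ` {..<4}" using new' e(1) by blast+
    then show ?thesis using g5(1) y(1) by auto
  qed
  moreover have "S \<subseteq> S2" using S1(1) S2(1) by (rule order_trans)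
  ultimately show ?case using S2(2,3) by (intro exI[of _ S2]) blast
qed

section \<open>Extending a finite forest\<close>

lemma finite_vertices: "finite S \<Longrightarrow> finite (vertices S)"
proof -
  assume "finite S"
  moreover have "vertices S \<subseteq> (\<lambda>(d, y, t, z). y) ` S \<union> (\<lambda>(d, y, t, z). z) ` S"
    unfolding vertices_def by force
  ultimately show ?thesis by (meson finite_UnI finite_imageI finite_subset)
qed

lemma saturatedD: "saturated S y \<Longrightarrow> t < 4 \<Longrightarrow> \<exists>z. move S t y z"
  unfolding saturated_def by blast

lemma saturated_subset_vertices: "{y. saturated S y} \<subseteq> vertices S"
proof
  fix y assume "y \<in> {y. saturated S y}"
  then obtain z where "move S 0 y z" using saturatedD[of S y 0] by auto
  then show "y \<in> vertices S" unfolding move_def vertices_def by blast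
qed

lemma finite_saturated: "finite S \<Longrightarrow> finite {y. saturated S y}"
  by (rule finite_subset[OF saturated_subset_vertices finite_vertices])

text \<open>Without children the only move leads to the unique parent, by a single letter; the
  letters 0 and 1 cannot both be realised.\<close>

lemma not_saturated_leaf:
  assumes S: "labelled_forest S" and y: "\<And>d t z. (d, y, t, z) \<notin> S"
  shows "\<not> saturated S y"
proof
  assume "saturated S y"
  then obtain z z' where "move S 0 y z" "move S 1 y z'"
    using saturatedD[of S y 0] saturatedD[of S y 1] by auto
  then obtain d d' where "(d, z, inv_letter 0, y) \<in> S" "(d', z', inv_letter 1, y) \<in> S"
    using y unfolding move_def by blast
  then have "inv_letter 0 = inv_letter 1" using labelled_forestD(2)[OF S] by blast
  then show False by (simp add: inv_letter_def)
qed

lemma finite_Image_of_finite_fibres: "finite F \<Longrightarrow> (\<And>x. finite (K `` {x})) \<Longrightarrow> finite (K `` F)"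
  by (subst Image_eq_UN) auto

text \<open>If near and far vertices separately satisfy the expansion condition with a constant \<open>2k\<close>,
  then \<open>max (2ka) (2kb) \<ge> k(a + b)\<close> gives it for mixed sets with the constant \<open>k\<close>. This reduces
  the expansion condition relative to a finite set to a finite check.\<close>

lemma expansion_from_local:
  fixes K :: "('a \<times> 'a) set"
  assumes symK: "sym K" and finK: "\<And>x. finite (K `` {x})"
    and growth: "\<And>F. finite F \<Longrightarrow> 2 * k * card F \<le> card (K `` F)"
    and near: "K `` (K `` P) \<subseteq> B"
    and loc: "\<And>F. finite F \<Longrightarrow> F \<subseteq> B \<Longrightarrow> F \<inter> P = {} \<Longrightarrow> 2 * k * card F \<le> card (K `` F - K `` P)"
    and F: "finite F" "F \<inter> P = {}"
  shows "k * card F \<le> card (K `` F - K `` P)"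
proof -
  have fin: "finite (K `` F - K `` P)" using finite_Image_of_finite_fibres[OF F(1) finK] by blast
  have "2 * k * card (F \<inter> B) \<le> card (K `` (F \<inter> B) - K `` P)"
    using F by (intro loc) auto
  also have "\<dots> \<le> card (K `` F - K `` P)" by (rule card_mono[OF fin]) blast
  finally have 1: "2 * k * card (F \<inter> B) \<le> card (K `` F - K `` P)" .
  have "2 * k * card (F - B) \<le> card (K `` (F - B))" using F by (intro growth) auto
  also have "\<dots> \<le> card (K `` F - K `` P)"
  proof (rule card_mono[OF fin])
    show "K `` (F - B) \<subseteq> K `` F - K `` P"
      using near symD[OF symK] by blast
  qed
  finally have 2: "2 * k * card (F - B) \<le> card (K `` F - K `` P)" .
  have "card F = card (F \<inter> B) + card (F - B)"
    by (subst card_Un_disjoint[symmetric]) (use F(1) in \<open>auto intro: arg_cong[of _ _ card]\<close>)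
  then have "2 * (k * card F) = 2 * k * card (F \<inter> B) + 2 * k * card (F - B)"
    by (simp add: algebra_simps)
  then show ?thesis using 1 2 by linarith
qed

text \<open>The set \<open>Q\<close> of saturated vertices of the extension minimises \<open>card (K `` Q) - 10 * card Q\<close>;
  minimality is exactly the expansion condition relative to \<open>Q\<close>.\<close>

lemma extend_forest:
  fixes K :: "('a \<times> 'a) set"
  assumes reflK: "\<And>x. (x, x) \<in> K" and finK: "\<And>x. finite (K `` {x})"
    and growth: "\<And>F. finite F \<Longrightarrow> 10 * card F \<le> card (K `` F)"
    and S: "labelled_forest S" "finite S"
    and edges: "\<And>d y t z. (d, y, t, z) \<in> S \<Longrightarrow> (y, z) \<in> K \<and> saturated S y"
    and P: "P = {y. saturated S y}"
    and expand: "\<And>F. finite F \<Longrightarrow> F \<inter> P = {} \<Longrightarrow> 5 * card F \<le> card (K `` F - K `` P)"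
  shows "\<exists>S'. S \<subseteq> S' \<and> finite S' \<and> labelled_forest S' \<and> saturated S' n \<and>
    (\<forall>d y t z. (d, y, t, z) \<in> S' \<longrightarrow> (y, z) \<in> K \<and> saturated S' y) \<and>
    (\<forall>F. finite F \<longrightarrow> F \<inter> {y. saturated S' y} = {} \<longrightarrow>
      10 * card F \<le> card (K `` F - K `` {y. saturated S' y}))"
proof -
  have finP: "finite P" using finite_saturated[OF S(2)] P by simp
  \<comment> \<open>By \<open>growth\<close> the subtraction is never truncated, so \<open>m\<close>
    is the true difference.\<close>
  define m where "m Q = card (K `` Q) - 10 * card Q" for Q
  obtain Q where Q: "finite Q" "insert n P \<subseteq> Q"
    and Qmin: "\<And>R. finite R \<Longrightarrow> insert n P \<subseteq> R \<Longrightarrow> m Q \<le> m R"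
    using ex_has_least_nat[of "\<lambda>Q. finite Q \<and> insert n P \<subseteq> Q" "insert n P" m] finP by auto
  have expandQ: "10 * card F \<le> card (K `` F - K `` Q)" if F: "finite F" "F \<inter> Q = {}" for F
  proof -
    have "m Q \<le> m (Q \<union> F)" using Q F by (intro Qmin) auto
    moreover have "card (Q \<union> F) = card Q + card F"
      using Q(1) F by (intro card_Un_disjoint) auto
    moreover have "card (K `` (Q \<union> F)) = card (K `` Q) + card (K `` F - K `` Q)"
    proof -
      have *: "K `` (Q \<union> F) = K `` Q \<union> (K `` F - K `` Q)" by blast
      show ?thesis unfolding *
        using finite_Image_of_finite_fibres[OF Q(1) finK] finite_Image_of_finite_fibres[OF F(1) finK] by (intro card_Un_disjoint) auto
    qed
    ultimately show ?thesis
      using growth[OF Q(1)] growth[of "Q \<union> F"] Q(1) F(1) by (simp add: m_def)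
  qed
  define G where "G = Q - P"
  have finG: "finite G" using Q(1) G_def by simp
  have "\<exists>c. inj_on c (G \<times> {..<5::nat}) \<and> (\<forall>y\<in>G. \<forall>j<5. c (y, j) \<in> K `` {y} - K `` P)"
  proof (rule Hall_marriage_multi[OF finG])
    show "finite (K `` {y} - K `` P)" for y using finK by blast
    fix J assume J: "J \<subseteq> G"
    have "5 * card J \<le> card (K `` J - K `` P)"
      using J finG G_def finite_subset by (intro expand) auto
    also have "K `` J - K `` P = (\<Union>y\<in>J. K `` {y} - K `` P)" by blast
    finally show "5 * card J \<le> card (\<Union>y\<in>J. K `` {y} - K `` P)" .
  qed
  then obtain c where c: "inj_on c (G \<times> {..<5::nat})"
    "\<And>y j. y \<in> G \<Longrightarrow> j < 5 \<Longrightarrow> c (y, j) \<in> K `` {y} - K `` P" by blast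
  \<comment> \<open>Old vertices lie in \<open>K\<close>
    P\<open>, being in\<close>P\<open>or children of vertices in\<close>P\<open>; the candidates avoid\<close>K
    \<open>P\<close> and are therefore fresh.\<close>
  have vert: "vertices S \<subseteq> K `` P"
    using edges reflK unfolding vertices_def P by blast
  have "\<exists>S'. S \<subseteq> S' \<and> finite S' \<and> labelled_forest S' \<and> (\<forall>y\<in>G. saturated S' y) \<and>
    (\<forall>d u t z. (d, u, t, z) \<in> S' \<longrightarrow> (d, u, t, z) \<notin> S \<longrightarrow> u \<in> G \<and> (\<exists>j<5. z = c (u, j)))"
  proof (rule add_block[OF finG c(1) S])
    show "(d, y, t, z) \<notin> S" if "y \<in> G" for d y t z
      using that edges unfolding G_def P by blast
    show "c (y, j) \<notin> vertices S" if "y \<in> G" "j < 5" for y j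
      using c(2)[OF that] vert by blast
  qed
  then obtain S' where S': "S \<subseteq> S'" "finite S'" "labelled_forest S'" "\<forall>y\<in>G. saturated S' y"
    and new: "\<forall>d u t z. (d, u, t, z) \<in> S' \<longrightarrow> (d, u, t, z) \<notin> S \<longrightarrow> u \<in> G \<and> (\<exists>j<5. z = c (u, j))"
    by (elim exE conjE)
  have source: "y \<in> Q \<and> (y, z) \<in> K" if e: "(d, y, t, z) \<in> S'" for d y t z
  proof (cases "(d, y, t, z) \<in> S")
    case True
    then show ?thesis using edges Q(2) P by blast
  next
    case False
    then obtain j where "y \<in> G" "j < 5" "z = c (y, j)" using new e by blast
    then show ?thesis using c(2) G_def by blast
  qed
  \<comment> \<open>Outside \<open>Q\<close> no vertex has children, so
    \<open>not_saturated_leaf\<close> excludes accidental saturation.\<close>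
  have sat: "{y. saturated S' y} = Q"
  proof
    show "{y. saturated S' y} \<subseteq> Q" using not_saturated_leaf[OF S'(3)] source by blast
    show "Q \<subseteq> {y. saturated S' y}"
      using S'(4) saturated_mono[OF _ S'(1)] P G_def by blast
  qed
  show ?thesis
  proof (intro exI[of _ S'] conjI)
    show "saturated S' n" using sat Q(2) by blast
    show "\<forall>d y t z. (d, y, t, z) \<in> S' \<longrightarrow> (y, z) \<in> K \<and> saturated S' y"
      using source sat by blast
    show "\<forall>F. finite F \<longrightarrow> F \<inter> {y. saturated S' y} = {} \<longrightarrow>
      10 * card F \<le> card (K `` F - K `` {y. saturated S' y})"
      unfolding sat using expandQ by blast
  qed (fact S')+
qed

section \<open>Finite forests as natural numbers\<close>

lemma recursive_inv_letter: "recursive a \<Longrightarrow> recursive (\<lambda>e. inv_letter (a e))"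
proof -
  assume a: "recursive a"
  have "recursive (\<lambda>e. (a e + 2) - 4 * ((a e + 2) div 4))"
    by (intro recursive_intros a)
  then show ?thesis unfolding inv_letter_def by (simp only: minus_mult_div_eq_mod)
qed

definition edge_code :: "nat \<Rightarrow> nat \<Rightarrow> nat \<Rightarrow> nat \<Rightarrow> nat" where
  "edge_code d y t z = prod_encode (d, prod_encode (y, prod_encode (t, z)))"

definition edges :: "nat \<Rightarrow> (nat \<times> nat \<times> nat \<times> nat) set" where
  "edges s = {(d, y, t, z). edge_code d y t z \<in> set_decode s}"

lemma mem_edges: "(d, y, t, z) \<in> edges s \<longleftrightarrow> edge_code d y t z \<in> set_decode s"
  by (simp add: edges_def)

lemma set_decode_le: "x \<in> set_decode s \<Longrightarrow> 2 ^ x \<le> s"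
  unfolding set_decode_def by (auto simp: not_le[symmetric] intro: ccontr)

lemma set_decode_less: "x \<in> set_decode s \<Longrightarrow> x < s"
  using set_decode_le[of x s] less_exp[of x] by linarith

text \<open>A code in \<open>set_decode s\<close> is below \<open>s\<close>, and pairing dominates
  its components. Thus \<open>s\<close> itself bounds all quantifiers over the edges it
  codes.\<close>

lemma edge_less:
  assumes "(d, y, t, z) \<in> edges s" shows "d < s" "y < s" "t < s" "z < s"
proof -
  have "edge_code d y t z < s" using assms by (simp add: mem_edges set_decode_less)
  then show "d < s" "y < s" "t < s" "z < s"
    using le_prod_encode_1[of d "prod_encode (y, prod_encode (t, z))"]
      le_prod_encode_2[of "prod_encode (y, prod_encode (t, z))" d]
      le_prod_encode_1[of y "prod_encode (t, z)"] le_prod_encode_2[of "prod_encode (t, z)" y]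
      le_prod_encode_1[of t z] le_prod_encode_2[of z t]
    unfolding edge_code_def by linarith+
qed

lemma finite_edges: "finite (edges s)"
proof (rule finite_subset)
  show "edges s \<subseteq> {..<s} \<times> {..<s} \<times> {..<s} \<times> {..<s}" using edge_less by auto
qed simp

lemma edges_surj:
  assumes "finite S" obtains s where "edges s = S"
proof
  let ?c = "\<lambda>(d, y, t, z). edge_code d y t z"
  have inj: "inj ?c" by (auto simp: inj_def edge_code_def prod_encode_eq)
  have "set_decode (set_encode (?c ` S)) = ?c ` S" using assms by simp
  then have "(d, y, t, z) \<in> edges (set_encode (?c ` S)) \<longleftrightarrow> (d, y, t, z) \<in> S" for d y t z
    using inj_image_mem_iff[OF inj, of "(d, y, t, z)" S] by (simp add: mem_edges)
  then show "edges (set_encode (?c ` S)) = S" by auto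
qed

lemma set_decode_lessThan: "f < 2 ^ B \<Longrightarrow> set_decode f \<subseteq> {..<B}"
  using set_decode_le by (fastforce dest: order.strict_trans1)

lemma set_encode_less:
  assumes "F \<subseteq> {..<B}" shows "set_encode F < 2 ^ B"
proof -
  have "set_encode F \<le> (\<Sum>i<B. 2 ^ i)"
    unfolding set_encode_def using assms by (intro sum_mono2) auto
  also have "\<dots> < 2 ^ B" by (induction B) auto
  finally show ?thesis .
qed

text \<open>Turns a quantifier over subsets of an initial segment into a bounded numerical one,
  which is decidable.\<close>

lemma all_subset_iff:
  "(\<forall>F. F \<subseteq> {..<B} \<longrightarrow> P F) \<longleftrightarrow> (\<forall>f<2 ^ B. P (set_decode f))"
  using set_decode_lessThan set_encode_less
  by (metis finite_lessThan finite_subset set_encode_inverse)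

section \<open>Forest conditions as bounded checks on codes\<close>

definition moveb :: "nat \<Rightarrow> nat \<Rightarrow> nat \<Rightarrow> nat \<Rightarrow> bool" where
  "moveb s t y z \<longleftrightarrow> (\<exists>d<s. edge_code d y t z \<in> set_decode s \<or>
    edge_code d z (inv_letter t) y \<in> set_decode s)"

definition saturatedb :: "nat \<Rightarrow> nat \<Rightarrow> bool" where
  "saturatedb s y \<longleftrightarrow> (\<forall>t<4. \<exists>z<s. moveb s t y z)"

definition forestb :: "nat \<Rightarrow> bool" where
  "forestb s \<longleftrightarrow> (\<forall>d<s. \<forall>y<s. \<forall>t<s. \<forall>z<s. edge_code d y t z \<in> set_decode s \<longrightarrow> t < 4 \<and>
     (\<forall>d'<s. \<forall>y'<s. \<forall>t'<s. edge_code d' y' t' z \<in> set_decode s \<longrightarrow> d' = d \<and> y' = y \<and> t' = t) \<and>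
     (\<forall>d'<s. \<forall>y'<s. \<forall>t'<s. edge_code d' y' t' y \<in> set_decode s \<longrightarrow> d' < d \<and> t \<noteq> inv_letter t') \<and>
     (\<forall>d'<s. \<forall>z'<s. edge_code d' y t z' \<in> set_decode s \<longrightarrow> z' = z))"

lemma moveb_iff: "moveb s t y z \<longleftrightarrow> move (edges s) t y z"
  unfolding moveb_def move_def mem_edges[symmetric] using edge_less(1) by blast

lemma saturatedb_iff: "saturatedb s y \<longleftrightarrow> saturated (edges s) y"
proof -
  have "z < s" if "move (edges s) t y z" for t z
    using that edge_less(2,4) unfolding move_def by blast
  then show ?thesis unfolding saturatedb_def saturated_def moveb_iff by blast
qed

lemma saturatedb_less: "saturatedb s y \<Longrightarrow> y < s"
  using saturated_subset_vertices[of "edges s"] edge_less(2,4)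
  unfolding saturatedb_iff vertices_def by blast

lemma forestb_iff: "forestb s \<longleftrightarrow> labelled_forest (edges s)"
proof -
  have 1: "(\<forall>d<s. \<forall>y<s. \<forall>t<s. \<forall>z<s. (d, y, t, z) \<in> edges s \<longrightarrow> Q d y t z) \<longleftrightarrow>
    (\<forall>d y t z. (d, y, t, z) \<in> edges s \<longrightarrow> Q d y t z)" for Q
    using edge_less by metis
  have 2: "(\<forall>d<s. \<forall>y<s. \<forall>t<s. (d, y, t, z) \<in> edges s \<longrightarrow> Q d y t) \<longleftrightarrow>
    (\<forall>d y t. (d, y, t, z) \<in> edges s \<longrightarrow> Q d y t)" for Q z
    using edge_less by metis
  have 3: "(\<forall>d<s. \<forall>z<s. (d, y, t, z) \<in> edges s \<longrightarrow> Q z) \<longleftrightarrow>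
    (\<forall>d z. (d, y, t, z) \<in> edges s \<longrightarrow> Q z)" for Q y t
    using edge_less by metis
  show ?thesis
    unfolding forestb_def labelled_forest_def mem_edges[symmetric] 1 2 3 ..
qed

lemma decidable_edge_code:
  "recursive s \<Longrightarrow> recursive d \<Longrightarrow> recursive y \<Longrightarrow> recursive t \<Longrightarrow> recursive z \<Longrightarrow>
    decidable (\<lambda>e. edge_code (d e) (y e) (t e) (z e) \<in> set_decode (s e))"
  unfolding edge_code_def by (intro recursive_intros)

lemma decidable_moveb: "decidable (\<lambda>e. moveb (e 0) (e 1) (e 2) (e 3))"
  unfolding moveb_def by (intro recursive_intros decidable_edge_code recursive_inv_letter)

lemma decidable_saturatedb: "decidable (\<lambda>e. saturatedb (e 0) (e 1))"
  unfolding saturatedb_def by (intro recursive_intros decidable_app4[OF decidable_moveb])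

lemma decidable_forestb: "decidable (\<lambda>e. forestb (e 0))"
  unfolding forestb_def by (intro recursive_intros decidable_edge_code recursive_inv_letter)

section \<open>The computable forest\<close>

locale computable_expansion =
  fixes E :: "(nat \<times> nat) set"
  assumes symE: "sym E" and highly_computable: "highly_computable E"
    and expansion: "finite F \<Longrightarrow> 6 * card F \<le> card (E `` F)"
begin

lemma finite_E: "finite (E `` {x})"
  using highly_computable unfolding highly_computable_def by blast

lemma decidable_E: "decidable (\<lambda>e. (e 0, e 1) \<in> E)"
  using highly_computable computable_rel_imp_decidable unfolding highly_computable_def by blast

text \<open>Here the computable degree enters: once as many neighbours have been found as the degree
  predicts, the search is complete.\<close>

definition neighbour_bound :: "nat \<Rightarrow> nat" where
  "neighbour_bound x = (LEAST b. (\<Sum>y<b. if (x, y) \<in> E then 1 else 0) = card (E `` {x}))"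

text \<open>A sum dominates each of its terms, so it replaces the maximum and is recursive at
  once.\<close>

definition reach_bound :: "nat \<Rightarrow> nat" where
  "reach_bound a = (\<Sum>x<Suc a. neighbour_bound x)"

lemma sum_indicator_eq_card: "(\<Sum>y<b. if P y then 1 else 0) = card {y. y < b \<and> P y}" for b :: nat
  by (simp add: sum.If_cases Int_def)

lemma neighbour_bound_exists: "\<exists>b. (\<Sum>y<b. if (x, y) \<in> E then 1 else 0) = card (E `` {x})"
proof -
  obtain b where b: "\<forall>y\<in>E `` {x}. y < b" using finite_E finite_nat_set_iff_bounded by blast
  have "{y. y < b \<and> (x, y) \<in> E} = E `` {x}" using b by auto
  then show ?thesis unfolding sum_indicator_eq_card by metis
qed

lemma neighbour_bound: "(x, y) \<in> E \<Longrightarrow> y < neighbour_bound x"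
proof -
  assume xy: "(x, y) \<in> E"
  let ?b = "neighbour_bound x"
  have "card {y. y < ?b \<and> (x, y) \<in> E} = card (E `` {x})"
    using LeastI_ex[OF neighbour_bound_exists[of x]]
    unfolding neighbour_bound_def[symmetric] unfolding sum_indicator_eq_card .
  then have "{y. y < ?b \<and> (x, y) \<in> E} = E `` {x}"
    by (intro card_subset_eq finite_E) auto
  then show ?thesis using xy by auto
qed

lemma reach_bound: "(x, y) \<in> E \<Longrightarrow> x \<le> a \<Longrightarrow> y < reach_bound a"
proof -
  assume "(x, y) \<in> E" "x \<le> a"
  then have "neighbour_bound x \<le> reach_bound a"
    unfolding reach_bound_def by (intro member_le_sum) auto
  then show ?thesis using neighbour_bound[OF \<open>(x, y) \<in> E\<close>] by simp
qed

lemma recursive_reach_bound: "recursive (\<lambda>e. reach_bound (e 0))"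
proof -
  have "recursive (\<lambda>e. card (E `` {e 0}))"
    using highly_computable computable_fun_iff_recursive[of "\<lambda>n. card (E `` {n})"]
    unfolding highly_computable_def by blast
  note card = recursive_app1[of "\<lambda>x. card (E `` {x})", OF this]
  have "recursive (\<lambda>e. neighbour_bound (e 0))"
    unfolding neighbour_bound_def
    by (intro card recursive_Least decidable_eq recursive_sum recursive_if decidable_app2[OF decidable_E]
      recursive_const recursive_var neighbour_bound_exists)
  note bound = recursive_app1[of neighbour_bound, OF this]
  show ?thesis
    unfolding reach_bound_def by (intro bound recursive_intros)
qed

section \<open>The expanding relation \<open>K\<close>\<close>

definition K :: "(nat \<times> nat) set" where
  "K = E O E"

definition adjb :: "nat \<Rightarrow> nat \<Rightarrow> bool" where
  "adjb x z \<longleftrightarrow> (\<exists>u<reach_bound x. (x, u) \<in> E \<and> (u, z) \<in> E)"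

lemma adjb_iff: "adjb x z \<longleftrightarrow> (x, z) \<in> K"
  unfolding adjb_def K_def using reach_bound[OF _ order_refl] by blast

lemma K_less: "(x, z) \<in> K \<Longrightarrow> x \<le> a \<Longrightarrow> z < reach_bound (reach_bound a)"
proof -
  assume "(x, z) \<in> K" "x \<le> a"
  then obtain y where y: "(x, y) \<in> E" "(y, z) \<in> E" unfolding K_def by blast
  have "y \<le> reach_bound a" using reach_bound[OF y(1) \<open>x \<le> a\<close>] by simp
  then show ?thesis by (rule reach_bound[OF y(2)])
qed

lemma decidable_adjb: "decidable (\<lambda>e. adjb (e 0) (e 1))"
  unfolding adjb_def
  by (intro recursive_intros recursive_app1[OF recursive_reach_bound] decidable_app2[OF decidable_E])

lemma sym_K: "sym K"
  using symE unfolding K_def sym_def by blast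

text \<open>Expansion gives \<open>x\<close> a neighbour, and symmetry leads back to
  \<open>x\<close>; \<open>E\<close> itself need not contain the diagonal.\<close>

lemma refl_K: "(x, x) \<in> K"
proof -
  have "card (E `` {x}) \<ge> 6" using expansion[of "{x}"] by simp
  then have "E `` {x} \<noteq> {}" by auto
  then obtain y where "(x, y) \<in> E" by blast
  then show ?thesis using symE unfolding K_def sym_def by blast
qed

lemma finite_K: "finite (K `` {x})"
  unfolding K_def relcomp_Image by (rule finite_Image_of_finite_fibres[OF finite_E finite_E])

text \<open>Two applications of the expansion give 36. The constant 10 is twice the five candidates
  per vertex, the factor 2 paying for the loss in \<open>expansion_from_local\<close>.\<close>

lemma K_expansion: "finite F \<Longrightarrow> 10 * card F \<le> card (K `` F)"
proof -
  assume F: "finite F"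
  have "10 * card F \<le> 6 * (6 * card F)" by simp
  also have "\<dots> \<le> 6 * card (E `` F)" using expansion[OF F] by simp
  also have "\<dots> \<le> card (E `` (E `` F))" by (rule expansion[OF finite_Image_of_finite_fibres[OF F finite_E]])
  finally show ?thesis by (simp add: K_def relcomp_Image)
qed

section \<open>The decidable condition on stages\<close>

text \<open>Saturated vertices are below \<open>s\<close>, and two steps in \<open>K\<close> are
  four steps in \<open>E\<close>; so everything in \<open>K\<close> (K \<open>P)\<close> lies below
  this bound.\<close>

definition local_bound :: "nat \<Rightarrow> nat" where
  "local_bound s = reach_bound (reach_bound (reach_bound (reach_bound s)))"

definition edgesb :: "nat \<Rightarrow> bool" where
  "edgesb s \<longleftrightarrow> (\<forall>d<s. \<forall>y<s. \<forall>t<s. \<forall>z<s. edge_code d y t z \<in> set_decode s \<longrightarrow>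
    adjb y z \<and> saturatedb s y)"

definition expandb :: "nat \<Rightarrow> bool" where
  "expandb s \<longleftrightarrow> (\<forall>f<2 ^ local_bound s.
    (\<forall>y<local_bound s. y \<in> set_decode f \<longrightarrow> \<not> saturatedb s y) \<longrightarrow>
    10 * (\<Sum>y<local_bound s. if y \<in> set_decode f then 1 else (0::nat)) \<le>
    (\<Sum>z<reach_bound (reach_bound (local_bound s)).
      if (\<exists>y<local_bound s. y \<in> set_decode f \<and> adjb y z) \<and> \<not> (\<exists>y<s. saturatedb s y \<and> adjb y z)
      then 1 else (0::nat)))"

definition good :: "nat \<Rightarrow> bool" where
  "good s \<longleftrightarrow> forestb s \<and> edgesb s \<and> expandb s"

lemma edgesb_iff: "edgesb s \<longleftrightarrow>
  (\<forall>d y t z. (d, y, t, z) \<in> edges s \<longrightarrow> (y, z) \<in> K \<and> saturated (edges s) y)"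
  unfolding edgesb_def mem_edges[symmetric] adjb_iff saturatedb_iff using edge_less by metis

lemma expandb_iff:
  defines "P \<equiv> \<lambda>s. {y. saturated (edges s) y}"
  shows "expandb s \<longleftrightarrow> (\<forall>F. F \<subseteq> {..<local_bound s} \<longrightarrow> F \<inter> P s = {} \<longrightarrow>
    10 * card F \<le> card (K `` F - K `` P s))"
proof -
  let ?B = "local_bound s"
  have P: "y \<in> P s \<longleftrightarrow> y < s \<and> saturatedb s y" for y
    using saturatedb_less by (auto simp: P_def saturatedb_iff)
  have "(\<forall>F. F \<subseteq> {..<?B} \<longrightarrow> F \<inter> P s = {} \<longrightarrow> 10 * card F \<le> card (K `` F - K `` P s)) \<longleftrightarrow>
    (\<forall>f<2 ^ ?B. set_decode f \<inter> P s = {} \<longrightarrow>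
      10 * card (set_decode f) \<le> card (K `` set_decode f - K `` P s))"
    by (rule all_subset_iff)
  also have "\<dots> \<longleftrightarrow> expandb s"
    unfolding expandb_def
  proof (intro all_cong imp_cong)
    fix f :: nat assume f: "f < 2 ^ ?B"
    have sub: "y < ?B" if "y \<in> set_decode f" for y using set_decode_lessThan[OF f] that by blast
    show "set_decode f \<inter> P s = {} \<longleftrightarrow> (\<forall>y<?B. y \<in> set_decode f \<longrightarrow> \<not> saturatedb s y)"
      using sub P saturatedb_less by blast
    have "set_decode f = {y. y < ?B \<and> y \<in> set_decode f}" using sub by blast
    then have card1: "card (set_decode f) = (\<Sum>y<?B. if y \<in> set_decode f then 1 else 0)"
      unfolding sum_indicator_eq_card by (rule arg_cong)
    have "K `` set_decode f - K `` P s = {z. z < reach_bound (reach_bound ?B) \<and>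
      (\<exists>y<?B. y \<in> set_decode f \<and> adjb y z) \<and> \<not> (\<exists>y<s. saturatedb s y \<and> adjb y z)}"
      using sub K_less less_imp_le P unfolding adjb_iff by blast
    then have card2: "card (K `` set_decode f - K `` P s) = (\<Sum>z<reach_bound (reach_bound ?B).
      if (\<exists>y<?B. y \<in> set_decode f \<and> adjb y z) \<and> \<not> (\<exists>y<s. saturatedb s y \<and> adjb y z)
      then 1 else 0)"
      unfolding sum_indicator_eq_card by (rule arg_cong)
    show "10 * card (set_decode f) \<le> card (K `` set_decode f - K `` P s) \<longleftrightarrow>
      10 * (\<Sum>y<?B. if y \<in> set_decode f then 1 else (0::nat)) \<le>
      (\<Sum>z<reach_bound (reach_bound ?B). if (\<exists>y<?B. y \<in> set_decode f \<and> adjb y z) \<and>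
        \<not> (\<exists>y<s. saturatedb s y \<and> adjb y z) then 1 else (0::nat))"
      unfolding card1 card2 ..
  qed
  finally show ?thesis ..
qed

lemma decidable_good: "decidable (\<lambda>e. good (e 0))"
proof -
  have B: "recursive (\<lambda>e. local_bound (e 0))"
    unfolding local_bound_def
    by (intro recursive_intros recursive_app1[OF recursive_reach_bound])
  have "decidable (\<lambda>e. edgesb (e 0))"
    unfolding edgesb_def by (intro recursive_intros decidable_edge_code
      decidable_app2[OF decidable_adjb] decidable_app2[OF decidable_saturatedb])
  moreover have "decidable (\<lambda>e. expandb (e 0))"
    unfolding expandb_def by (intro recursive_intros recursive_app1[OF B]
      recursive_app1[OF recursive_reach_bound]
      decidable_app2[OF decidable_adjb] decidable_app2[OF decidable_saturatedb])
  ultimately show ?thesis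
    unfolding good_def by (intro decidable_conj decidable_forestb)
qed

lemma good_0: "good 0"
proof -
  have 0: "edges 0 = {}" by (simp add: edges_def)
  have P: "{y. saturated {} y} = ({} :: nat set)"
    using saturated_subset_vertices[of "{}"] by (auto simp: vertices_def)
  have "10 * card F \<le> card (K `` F)" if "F \<subseteq> {..<b}" for F b
    using that by (intro K_expansion) (rule finite_subset, auto)
  then show ?thesis
    unfolding good_def forestb_iff edgesb_iff expandb_iff 0 P by (simp add: labelled_forest_def)
qed

text \<open>The local check with constant 10 gives the global bound with constant 5, from which
  \<open>extend_forest\<close> starts. It returns constant 10 for all finite sets, so the new local
  check holds however far its bound has grown.\<close>

lemma extend_good:
  assumes "good s"
  shows "\<exists>w. good w \<and> edges s \<subseteq> edges w \<and> saturatedb w n"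
proof -
  let ?P = "{y. saturated (edges s) y}"
  have forest: "labelled_forest (edges s)"
    and edges: "\<And>d y t z. (d, y, t, z) \<in> edges s \<Longrightarrow> (y, z) \<in> K \<and> saturated (edges s) y"
    and loc: "\<And>F. F \<subseteq> {..<local_bound s} \<Longrightarrow> F \<inter> ?P = {} \<Longrightarrow> 10 * card F \<le> card (K `` F - K `` ?P)"
    using assms unfolding good_def forestb_iff edgesb_iff expandb_iff by blast+
  have P: "y < s" if "y \<in> ?P" for y using that saturatedb_less saturatedb_iff by blast
  have near: "K `` (K `` ?P) \<subseteq> {..<local_bound s}"
  proof
    fix z assume "z \<in> K `` (K `` ?P)"
    then obtain x y where "x \<in> ?P" "(x, y) \<in> K" "(y, z) \<in> K" by blast
    then show "z \<in> {..<local_bound s}"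
      using K_less[of y z] K_less[of x y s] P[of x] unfolding local_bound_def by simp
  qed
  have expand: "5 * card F \<le> card (K `` F - K `` ?P)" if "finite F" "F \<inter> ?P = {}" for F
    by (rule expansion_from_local[OF sym_K finite_K _ near _ that])
       (use K_expansion loc in auto)
  have "\<exists>S'. edges s \<subseteq> S' \<and> finite S' \<and> labelled_forest S' \<and> saturated S' n \<and>
    (\<forall>d y t z. (d, y, t, z) \<in> S' \<longrightarrow> (y, z) \<in> K \<and> saturated S' y) \<and>
    (\<forall>F. finite F \<longrightarrow> F \<inter> {y. saturated S' y} = {} \<longrightarrow>
      10 * card F \<le> card (K `` F - K `` {y. saturated S' y}))"
    by (rule extend_forest[OF refl_K finite_K K_expansion forest finite_edges _ refl])
       (fact edges expand | assumption)+
  then obtain S' where S': "edges s \<subseteq> S'" "finite S'" "labelled_forest S'" "saturated S' n"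
    and edges': "\<forall>d y t z. (d, y, t, z) \<in> S' \<longrightarrow> (y, z) \<in> K \<and> saturated S' y"
    and expand': "\<forall>F. finite F \<longrightarrow> F \<inter> {y. saturated S' y} = {} \<longrightarrow>
      10 * card F \<le> card (K `` F - K `` {y. saturated S' y})"
    by (elim exE conjE)
  obtain w where w: "edges w = S'" using edges_surj[OF S'(2)] .
  have "good w"
    unfolding good_def forestb_iff edgesb_iff expandb_iff w
    using S'(3) edges' expand' finite_subset[OF _ finite_lessThan] by (intro conjI) blast+
  then show ?thesis using w S' saturatedb_iff by blast
qed

section \<open>The sequence of stages and its limit\<close>

text \<open>The disjunct \<open>\<not> good s\<close> makes the search succeed for every
  \<open>s\<close>, so that the minimisation is total.\<close>

definition next_state :: "nat \<Rightarrow> nat \<Rightarrow> nat" where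
  "next_state n s = (LEAST w. \<not> good s \<or>
    good w \<and> (\<forall>x<s. x \<in> set_decode s \<longrightarrow> x \<in> set_decode w) \<and> saturatedb w n)"

definition state :: "nat \<Rightarrow> nat" where
  "state n = rec_nat 0 next_state n"

lemma edges_mono: "(\<forall>x<s. x \<in> set_decode s \<longrightarrow> x \<in> set_decode w) \<longleftrightarrow> edges s \<subseteq> edges w"
proof
  assume "edges s \<subseteq> edges w"
  moreover have "\<exists>d y t z. x = edge_code d y t z" for x
    unfolding edge_code_def by (metis prod_decode_inverse surj_pair)
  ultimately show "\<forall>x<s. x \<in> set_decode s \<longrightarrow> x \<in> set_decode w"
    unfolding subset_iff by (metis mem_edges)
next
  assume "\<forall>x<s. x \<in> set_decode s \<longrightarrow> x \<in> set_decode w"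
  then show "edges s \<subseteq> edges w" using set_decode_less by (auto simp: edges_def)
qed

lemma next_state_exists: "\<exists>w. \<not> good s \<or>
    good w \<and> (\<forall>x<s. x \<in> set_decode s \<longrightarrow> x \<in> set_decode w) \<and> saturatedb w n"
  unfolding edges_mono using extend_good by blast

lemma recursive_state: "recursive (\<lambda>e. state (e 0))"
proof -
  have "recursive (\<lambda>e. next_state (e 0) (e 1))"
    unfolding next_state_def
    by (intro recursive_Least next_state_exists recursive_intros decidable_app1[OF decidable_good]
      decidable_app2[OF decidable_saturatedb])
  then show ?thesis
    unfolding state_def by (intro recursive_rec_nat recursive_intros)
qed

lemma next_state:
  assumes "good s"
  shows "good (next_state n s)" "edges s \<subseteq> edges (next_state n s)" "saturatedb (next_state n s) n"
  using LeastI_ex[OF next_state_exists[of s n]] assms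
  unfolding next_state_def[symmetric] unfolding edges_mono by blast+

lemma good_state: "good (state n)"
  by (induction n) (simp_all add: state_def good_0 next_state)

lemma edges_state_mono: "m \<le> n \<Longrightarrow> edges (state m) \<subseteq> edges (state n)"
proof (induction n rule: dec_induct)
  case (step n)
  have "edges (state n) \<subseteq> edges (state (Suc n))"
    using next_state(2)[OF good_state] by (simp add: state_def)
  then show ?case using step.IH by blast
qed simp

lemma saturated_state: "saturatedb (state (Suc n)) n"
  using next_state(3)[OF good_state] by (simp add: state_def)

definition forest :: "(nat \<times> nat \<times> nat \<times> nat) set" where
  "forest = (\<Union>n. edges (state n))"

text \<open>Each condition concerns at most two edges, and the stages increase, so both edges lie in
  a common stage.\<close>

lemma labelled_forest: "labelled_forest forest"
proof -
  have common: "\<exists>n. p \<in> edges (state n) \<and> q \<in> edges (state n)" if pq: "p \<in> forest" "q \<in> forest" for p q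
  proof -
    obtain i j where "p \<in> edges (state i)" "q \<in> edges (state j)" using pq unfolding forest_def by blast
    then have "p \<in> edges (state (max i j))" "q \<in> edges (state (max i j))"
      using edges_state_mono[of i "max i j"] edges_state_mono[of j "max i j"] by auto
    then show ?thesis by blast
  qed
  have lf: "labelled_forest (edges (state n))" for n
    using good_state good_def forestb_iff by blast
  show ?thesis
    unfolding labelled_forest_def
  proof (intro allI impI conjI)
    fix d y t z assume e: "(d, y, t, z) \<in> forest"
    obtain n where "(d, y, t, z) \<in> edges (state n)" using common[OF e e] by blast
    then show "t < 4" by (rule labelled_forestD(1)[OF lf])
    fix d' y' t' assume e': "(d', y', t', z) \<in> forest"
    obtain n where "(d, y, t, z) \<in> edges (state n)" "(d', y', t', z) \<in> edges (state n)"
      using common[OF e e'] by blast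
    then show "d' = d" "y' = y" "t' = t" using labelled_forestD(2)[OF lf] by blast+
  next
    fix d y t z d' y' t' assume e: "(d, y, t, z) \<in> forest" "(d', y', t', y) \<in> forest"
    obtain n where "(d, y, t, z) \<in> edges (state n)" "(d', y', t', y) \<in> edges (state n)"
      using common[OF e] by blast
    then show "d' < d" "t \<noteq> inv_letter t'" using labelled_forestD(3,4)[OF lf] by blast+
  next
    fix d y t z d' z' assume e: "(d, y, t, z) \<in> forest" "(d', y, t, z') \<in> forest"
    obtain n where "(d, y, t, z) \<in> edges (state n)" "(d', y, t, z') \<in> edges (state n)"
      using common[OF e] by blast
    then show "z' = z" using labelled_forestD(5)[OF lf] by blast
  qed
qed

section \<open>The permutations read off from the forest\<close>

text \<open>Round \<open>y\<close> saturates \<open>y\<close>, so the finite stage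
  \<open>Suc y\<close> already contains the answer, and moves persist in the limit.\<close>

definition act :: "nat \<Rightarrow> nat \<Rightarrow> nat" where
  "act t y = (LEAST z. moveb (state (Suc y)) t y z)"

lemma moveb_exists: "t < 4 \<Longrightarrow> \<exists>z. moveb (state (Suc y)) t y z"
  using saturated_state[of y] unfolding saturatedb_def by blast

lemma move_act: assumes "t < 4" shows "move forest t y (act t y)"
proof -
  have "move (edges (state (Suc y))) t y (act t y)"
    using LeastI_ex[OF moveb_exists[OF assms]] unfolding act_def moveb_iff .
  then show ?thesis unfolding move_def forest_def by blast
qed

sublocale forest_action forest act
  by unfold_locales (fact labelled_forest, fact move_act)

lemma computable_act: "t < 4 \<Longrightarrow> computable_fun (act t)"
  unfolding computable_fun_iff_recursive act_def
  by (intro recursive_Least moveb_exists decidable_app4[OF decidable_moveb]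
    recursive_app1[OF recursive_state] recursive_intros)

lemma act_in_K: assumes "t < 4" shows "(y, act t y) \<in> K"
proof -
  have K: "(u, v) \<in> K" if "(d, u, s, v) \<in> forest" for d u s v
    using that good_state edgesb_iff unfolding forest_def good_def by blast
  show ?thesis
    using move_act[OF assms, of y] K symD[OF sym_K] unfolding move_def by blast
qed

end

section \<open>The generated permutation group\<close>

lemma carrier_BijGroup_UNIV: "f \<in> carrier (BijGroup UNIV) \<longleftrightarrow> bij f"
  by (simp add: BijGroup_def Bij_def extensional_def)

lemma mult_BijGroup_UNIV: "bij g \<Longrightarrow> bij f \<Longrightarrow> g \<otimes>\<^bsub>BijGroup UNIV\<^esub> f = g \<circ> f"
  by (simp add: BijGroup_def Bij_def extensional_def compose_def fun_eq_iff)

lemma one_BijGroup_UNIV: "\<one>\<^bsub>BijGroup UNIV\<^esub> = id"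
  by (simp add: BijGroup_def fun_eq_iff)

lemma inv_BijGroup_UNIV:
  assumes "bij f" "\<And>x. g (f x) = x" shows "inv\<^bsub>BijGroup UNIV\<^esub> f = g"
proof -
  have g: "g = inv_into UNIV f" using assms by (metis bij_inv_eq_iff ext)
  then have "bij g" using assms(1) bij_imp_bij_inv by blast
  then have "g \<otimes>\<^bsub>BijGroup UNIV\<^esub> f = \<one>\<^bsub>BijGroup UNIV\<^esub>"
    using assms by (simp add: mult_BijGroup_UNIV one_BijGroup_UNIV fun_eq_iff)
  then show ?thesis
    using group.inv_equality[OF group_BijGroup] assms(1) \<open>bij g\<close> carrier_BijGroup_UNIV by blast
qed

section \<open>Reduced words in a group\<close>

context group
begin

lemma word_value_closed: "fst ` set w \<subseteq> carrier G \<Longrightarrow> word_value G w \<in> carrier G"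
  by (induction w) auto

text \<open>Either the letter cancels against the head of the word, leaving a reduced tail, or it
  can be put in front.\<close>

lemma prepend_letter:
  assumes S: "S \<subseteq> carrier G" and s: "s \<in> S" and w: "fst ` set w \<subseteq> S" "reduced_word w"
  shows "\<exists>w'. fst ` set w' \<subseteq> S \<and> reduced_word w' \<and>
    word_value G w' = (if b then s else inv s) \<otimes> word_value G w"
proof (cases "\<exists>u. w = (s, \<not> b) # u")
  case True
  then obtain u where u: "w = (s, \<not> b) # u" by blast
  have "word_value G u \<in> carrier G" "s \<in> carrier G"
    using S s w(1) u by (auto intro: word_value_closed)
  then have "word_value G u = (if b then s else inv s) \<otimes> word_value G w"
    unfolding u by (cases b) (auto simp: m_assoc[symmetric])
  moreover have "fst ` set u \<subseteq> S" "reduced_word u"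
    using w u by (auto simp: reduced_word_def successively_Cons)
  ultimately show ?thesis by metis
next
  case False
  have "reduced_word ((s, b) # w)"
    using False w(2) by (cases w) (auto simp: reduced_word_def)
  moreover have "fst ` set ((s, b) # w) \<subseteq> S" using s w by auto
  ultimately show ?thesis by (intro exI[of _ "(s, b) # w"]) auto
qed

lemma prepend_word:
  assumes S: "S \<subseteq> carrier G" and v: "fst ` set v \<subseteq> S" and w: "fst ` set w \<subseteq> S" "reduced_word w"
  shows "\<exists>w'. fst ` set w' \<subseteq> S \<and> reduced_word w' \<and>
    word_value G w' = word_value G v \<otimes> word_value G w"
  using v
proof (induction v)
  case Nil
  then show ?case using w S word_value_closed[of w] by (intro exI[of _ w]) auto
next
  case (Cons l v)
  obtain s b where l: "l = (s, b)" by (cases l)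
  obtain w' where w': "fst ` set w' \<subseteq> S" "reduced_word w'"
    "word_value G w' = word_value G v \<otimes> word_value G w"
    using Cons by auto
  have s: "s \<in> S" using Cons.prems l by simp
  have "word_value G v \<in> carrier G" "word_value G w \<in> carrier G" "s \<in> carrier G"
    using Cons.prems w S s by (auto intro!: word_value_closed)
  then show ?case
    using prepend_letter[OF S s w'(1,2), of b] w'(3) l by (auto simp: m_assoc)
qed

text \<open>Reduces semi-regularity to \<open>no_fixed_point\<close>: a non-identity element of the
  generated group is the value of a non-empty reduced word.\<close>

lemma generate_reduced_word:
  assumes S: "S \<subseteq> carrier G" and "g \<in> generate G S"
  shows "\<exists>w. fst ` set w \<subseteq> S \<and> reduced_word w \<and> word_value G w = g"
  using assms(2)
proof (induction rule: generate.induct)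
  case one
  then show ?case by (intro exI[of _ "[]"]) (auto simp: reduced_word_def)
next
  case (incl h)
  then show ?case using S by (intro exI[of _ "[(h, True)]"]) (auto simp: reduced_word_def)
next
  case (inv h)
  then show ?case using S by (intro exI[of _ "[(h, False)]"]) (auto simp: reduced_word_def)
next
  case (eng h1 h2)
  then show ?case using prepend_word[OF S] by metis
qed

lemma word_value_subgroup:
  assumes "subgroup H G" "fst ` set w \<subseteq> H"
  shows "word_value (G\<lparr>carrier := H\<rparr>) w = word_value G w"
  using assms(2)
  by (induction w) (auto simp: m_inv_consistent[OF assms(1)])

end

section \<open>The free semi-regular group generated by \<open>act 0\<close> and
  \<open>act 1\<close>\<close>

context forest_action
begin

lemma bij_act: "t < 4 \<Longrightarrow> bij (act t)"
  by (rule bij_betw_byWitness[of _ "act (inv_letter t)"]) auto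

text \<open>Were they equal, the reduced word \<open>[0, 3]\<close>, that is \<sigma> followed by
  the inverse of \<pi> in writing order, would act trivially.\<close>

lemma act_0_neq_act_1: "act 0 \<noteq> act 1"
proof
  assume eq: "act 0 = act 1"
  have inv1: "inv_letter 1 = 3" by (simp add: inv_letter_def)
  have "act 1 (act 3 x) = x" for x by (rule act_inv'[of 1 x, unfolded inv1]) simp
  then have "foldr act [0, 3] x = x" for x by (simp add: eq)
  then show False
    using no_fixed_point[of "[0, 3]"] by (simp add: reduced_letters_def inv_letter_def)
qed

text \<open>Every first component other than \<open>act 0\<close> is read as \<open>act 1\<close>;
  this is faithful on words over the two generators, which are distinct.\<close>

definition letter :: "('a \<Rightarrow> 'a) \<times> bool \<Rightarrow> nat" where
  "letter l = (if fst l = act 0 then if snd l then 0 else 2 else if snd l then 1 else 3)"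

lemma inv_letter_letter: "inv_letter (letter (s, b)) = letter (s, \<not> b)"
  by (simp add: letter_def inv_letter_def)

lemma letter_less: "letter l < 4"
  by (simp add: letter_def)

lemma word_value_eq_foldr:
  assumes "fst ` set w \<subseteq> {act 0, act 1}"
  shows "word_value (BijGroup UNIV) w = foldr act (map letter w) \<and>
    bij (word_value (BijGroup UNIV) w)"
  using assms
proof (induction w)
  case Nil
  then show ?case by (simp add: one_BijGroup_UNIV fun_eq_iff bij_id[unfolded id_def])
next
  case (Cons l w)
  obtain s b where l: "l = (s, b)" by (cases l)
  have s: "s = act 0 \<or> s = act 1" using Cons.prems l by auto
  have inv: "inv\<^bsub>BijGroup UNIV\<^esub> (act t) = act (t + 2)" if "t < 2" for t
  proof (rule inv_BijGroup_UNIV)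
    show "bij (act t)" using that by (intro bij_act) simp
    have "inv_letter t = t + 2" using that by (simp add: inv_letter_def)
    then show "act (t + 2) (act t x) = x" for x using act_inv[of t x] that by simp
  qed
  have *: "(if b then s else inv\<^bsub>BijGroup UNIV\<^esub> s) = act (letter l)"
    using s
  proof
    assume "s = act 0"
    then show ?thesis using inv[of 0] l by (simp add: letter_def numeral_2_eq_2)
  next
    assume "s = act 1"
    then show ?thesis using inv[of 1] l act_0_neq_act_1 by (simp add: letter_def numeral_3_eq_3)
  qed
  have IH: "word_value (BijGroup UNIV) w = foldr act (map letter w)"
    "bij (word_value (BijGroup UNIV) w)" using Cons by auto
  have eq: "word_value (BijGroup UNIV) (l # w) = act (letter l) \<circ> word_value (BijGroup UNIV) w"
    using mult_BijGroup_UNIV[OF bij_act[OF letter_less] IH(2)] * l by simp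
  show ?case
    unfolding eq using bij_comp[OF IH(2) bij_act[OF letter_less, of l]] IH(1) by (simp add: comp_def)
qed

lemma reduced_letters_map:
  assumes "fst ` set w \<subseteq> {act 0, act 1}" "reduced_word w"
  shows "reduced_letters (map letter w)"
proof -
  have *: "letter (s, b) \<noteq> inv_letter (letter (t, c))"
    if "s = t \<longrightarrow> b = c" "s \<in> {act 0, act 1}" "t \<in> {act 0, act 1}" for s b t c
    using that act_0_neq_act_1 unfolding inv_letter_letter
    by (cases b; cases c) (auto simp: letter_def)
  have "successively (\<lambda>l m. letter l \<noteq> inv_letter (letter m)) w"
  proof (rule successively_mono)
    show "successively (\<lambda>(s, b) (t, c). s = t \<longrightarrow> b = c) w"
      using assms(2) by (simp add: reduced_word_def)
    fix l m assume lm: "l \<in> set w" "m \<in> set w" "(\<lambda>(s, b) (t, c). s = t \<longrightarrow> b = c) l m"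
    then have "fst l \<in> {act 0, act 1}" "fst m \<in> {act 0, act 1}" using assms(1) by blast+
    then show "letter l \<noteq> inv_letter (letter m)"
      using * lm(3) by (cases l; cases m) auto
  qed
  then show ?thesis unfolding reduced_letters_def successively_map .
qed

lemma word_no_fixed_point:
  assumes "fst ` set w \<subseteq> {act 0, act 1}" "reduced_word w" "w \<noteq> []"
  shows "word_value (BijGroup UNIV) w x \<noteq> x"
  using no_fixed_point[of "map letter w" x] reduced_letters_map[OF assms(1,2)] assms
    word_value_eq_foldr[OF assms(1)] letter_less by (auto simp: image_subset_iff)

lemma generators_in_carrier: "{act 0, act 1} \<subseteq> carrier (BijGroup UNIV)"
  using bij_act by (simp add: carrier_BijGroup_UNIV)

lemma semi_regular_generate: "semi_regular UNIV (generate (BijGroup UNIV) {act 0, act 1})"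
  unfolding semi_regular_def
proof (intro conjI ballI impI)
  show "subgroup (generate (BijGroup UNIV) {act 0, act 1}) (BijGroup UNIV)"
    by (rule group.generate_is_subgroup[OF group_BijGroup generators_in_carrier])
  fix g x
  assume "g \<in> generate (BijGroup UNIV) {act 0, act 1}" and g: "g \<noteq> \<one>\<^bsub>BijGroup UNIV\<^esub>"
  then obtain w where w: "fst ` set w \<subseteq> {act 0, act 1}" "reduced_word w"
    "word_value (BijGroup UNIV) w = g"
    using group.generate_reduced_word[OF group_BijGroup generators_in_carrier] by blast
  then have "w \<noteq> []" using g by auto
  then show "g x \<noteq> x" using word_no_fixed_point[OF w(1,2)] w(3) by blast
qed

lemma free_generate:
  "free_group_of_rank ((BijGroup UNIV)\<lparr>carrier := generate (BijGroup UNIV) {act 0, act 1}\<rparr>) 2"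
proof -
  let ?B = "BijGroup (UNIV :: 'a set)" and ?S = "{act 0, act 1}"
  let ?G = "generate ?B ?S"
  interpret group ?B by (rule group_BijGroup)
  have sub: "subgroup ?G ?B" by (rule generate_is_subgroup[OF generators_in_carrier])
  have SG: "?S \<subseteq> ?G" by (auto intro: generate.incl)
  have "word_value (?B\<lparr>carrier := ?G\<rparr>) w \<noteq> \<one>\<^bsub>?B\<lparr>carrier := ?G\<rparr>\<^esub>"
    if w: "fst ` set w \<subseteq> ?S" "reduced_word w" "w \<noteq> []" for w
  proof -
    have "word_value (?B\<lparr>carrier := ?G\<rparr>) w = word_value ?B w"
      using w(1) SG by (intro word_value_subgroup[OF sub]) blast
    then show ?thesis using word_no_fixed_point[OF w] by (auto simp: one_BijGroup_UNIV)
  qed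
  moreover have "generate (?B\<lparr>carrier := ?G\<rparr>) ?S = ?G" by (rule generate_consistent[OF SG sub])
  ultimately have "free_basis (?B\<lparr>carrier := ?G\<rparr>) ?S"
    using SG unfolding free_basis_def by simp
  moreover have "card ?S = 2" using act_0_neq_act_1 by simp
  ultimately show ?thesis
    unfolding free_group_of_rank_def
    by (intro conjI exI[of _ ?S] subgroup_imp_group[OF sub] finite.intros)
qed

end

section \<open>Membership in the wobbling group and the conclusion\<close>

lemma wobbling_subgroup:
  fixes \<E> :: "('a \<times> 'a) set set"
  assumes "coarse_space UNIV \<E>"
  shows "subgroup (carrier (wobbling_group UNIV \<E>)) (BijGroup UNIV)"
proof -
  interpret coarse_space UNIV \<E> by fact
  let ?W = "{\<alpha> \<in> carrier (BijGroup UNIV). {(x, \<alpha> x) |x. x \<in> UNIV} \<in> \<E>}"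
  interpret group "BijGroup UNIV" by (rule group_BijGroup)
  have "subgroup ?W (BijGroup UNIV)"
  proof
    show "?W \<subseteq> carrier (BijGroup UNIV)" by blast
    have "{(x, id x) |x. x \<in> UNIV} = Id_on (UNIV :: 'a set)" by auto
    then show "\<one>\<^bsub>BijGroup UNIV\<^esub> \<in> ?W"
      using diagonal one_closed by (simp add: one_BijGroup_UNIV)
    fix f assume f: "f \<in> ?W"
    then have bf: "bij f" by (simp add: carrier_BijGroup_UNIV)
    let ?g = "inv_into UNIV f"
    have inv: "inv\<^bsub>BijGroup UNIV\<^esub> f = ?g"
      by (rule inv_BijGroup_UNIV[OF bf]) (simp add: bf bij_is_inj)
    have "{(x, ?g x) |x. x \<in> UNIV} = {(x, f x) |x. x \<in> UNIV}\<inverse>"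
      using bf by (auto simp: bij_inv_eq_iff) (metis bij_inv_eq_iff)
    then show "inv\<^bsub>BijGroup UNIV\<^esub> f \<in> ?W"
      using f converse_closed inv_closed[of f] inv by simp
    fix g assume g: "g \<in> ?W"
    then have bg: "bij g" by (simp add: carrier_BijGroup_UNIV)
    \<comment> \<open>\<open>O\<close> composes from left to right, so the graph of \<open>g\<close>
      comes first.\<close>
    have "{(x, (f \<circ> g) x) |x. x \<in> UNIV} = {(x, g x) |x. x \<in> UNIV} O {(x, f x) |x. x \<in> UNIV}"
      by auto
    then show "f \<otimes>\<^bsub>BijGroup UNIV\<^esub> g \<in> ?W"
      using f g comp_closed m_closed[of f g] mult_BijGroup_UNIV[OF bf bg] by simp
  qed
  then show ?thesis by (simp add: wobbling_group_def)
qed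

lemma generate_subgroup_wobbling:
  fixes \<E> :: "('a \<times> 'a) set set"
  assumes X: "coarse_space UNIV \<E>" and S: "S \<subseteq> carrier (wobbling_group UNIV \<E>)"
  shows "subgroup (generate (BijGroup UNIV) S) (wobbling_group UNIV \<E>)"
proof -
  interpret group "BijGroup UNIV" by (rule group_BijGroup)
  let ?W = "carrier (wobbling_group UNIV \<E>)"
  have W: "subgroup ?W (BijGroup UNIV)" by (rule wobbling_subgroup[OF X])
  have "subgroup (generate (BijGroup UNIV) S) (BijGroup UNIV)"
    using S subgroup.subset[OF W] by (intro generate_is_subgroup) blast
  then have "subgroup (generate (BijGroup UNIV) S) ((BijGroup UNIV)\<lparr>carrier := ?W\<rparr>)"
    using W generate_subgroup_incl[OF S W] by (rule subgroup_incl)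
  then show ?thesis by (simp add: wobbling_group_def)
qed

theorem theorem2:
  fixes \<E> :: "(nat \<times> nat) set set" and E :: "(nat \<times> nat) set"
  assumes "bounded_geometry_coarse_space UNIV \<E>"
    and "\<not> amenable UNIV \<E>"
    and "E \<in> \<E>" and "sym E" and "highly_computable E"
    and "\<And>F. finite F \<Longrightarrow> card (E `` F) \<ge> 6 * card F"
  shows "\<exists>\<sigma> \<pi>. \<sigma> \<in> carrier (BijGroup UNIV) \<and> computable_fun \<sigma> \<and>
           \<pi> \<in> carrier (BijGroup UNIV) \<and> computable_fun \<pi> \<and>
           (let G = generate (BijGroup UNIV) {\<sigma>, \<pi>} in
              subgroup G (wobbling_group UNIV \<E>) \<and>
              free_group_of_rank ((BijGroup UNIV)\<lparr>carrier := G\<rparr>) 2 \<and>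
              semi_regular UNIV G)"
proof -
  interpret bounded_geometry_coarse_space UNIV \<E> by fact
  interpret computable_expansion E
    using assms by unfold_locales auto
  \<comment> \<open>Both generators move points along \<open>K\<close>, so their graphs are subsets
    of one entourage.\<close>
  have "K \<in> \<E>" unfolding K_def using assms(3) by (intro comp_closed)
  then have graph: "{(x, act t x) |x. x \<in> UNIV} \<in> \<E>" if "t < 4" for t
    by (rule subset_closed) (use act_in_K[OF that] in auto)
  have bij: "act 0 \<in> carrier (BijGroup UNIV)" "act 1 \<in> carrier (BijGroup UNIV)"
    using generators_in_carrier by simp_all
  have "{act 0, act 1} \<subseteq> carrier (wobbling_group UNIV \<E>)"
    using graph[of 0] graph[of 1] bij by (simp add: wobbling_group_def)
  then have "subgroup (generate (BijGroup UNIV) {act 0, act 1}) (wobbling_group UNIV \<E>)"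
    by (rule generate_subgroup_wobbling[OF coarse_space_axioms])
  then show ?thesis
    unfolding Let_def using bij computable_act[of 0] computable_act[of 1]
      free_generate semi_regular_generate
    by (intro exI[of _ "act 0"] exI[of _ "act 1"] conjI) simp_all
qed

end
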